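(* Let $\gamma>0$ and let $F$ be a distribution function on $\mathbb{R}$ with $F\in\mathcal{S}_\gamma$ and $\hat\varphi_F<1$. Let $\{\xi_n\}_{n\ge1}$ be i.i.d. random variables with distribution function $F$, and let $S_n$, $M_n$, $M$ and the events $A_n^{a,x}$ be defined from $\{\xi_n\}$ as in the context. Then, for each $N\ge1$, and for any positive function $h$ with $h(x)\le x/2$ for all $x>0$ and $\lim_{x\to\infty}h(x)=\infty$, $$\lim_{x\to\infty}\frac{1}{\overline{F}(x)}\mathbf{P}\biggl(M_N>x,\,\bigcup_{1\le n\le N}A_n^{h(x),x-h(x)}\biggr)=\lim_{x\to\infty}\frac{\mathbf{P}(M_N>x)}{\overline{F}(x)}=\sum_{n=1}^N\hat\varphi_F^{\,n-1}\,\mathbf{E} e^{\gamma M_{N-n}},$$ where the convergence (in both limits) is uniform over all $N\le\infty$, i.e. over $N\in\{1,2,\dots\}\cup\{\infty\}$; for $N=\infty$ one reads $M_\infty=M$, the union is over all $n\ge1$, and the right-hand side is $\sum_{n\ge1}\hat\varphi_F^{\,n-1}\mathbf{E} e^{\gamma M}=\mathbf{E} e^{\gamma M}/(1-\hat\varphi_F)$.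
   Context: For a distribution function $F$ on $\mathbb{R}$, let $\overline{F}(x)=1-F(x)$, let $\varphi_F(\alpha)=\int_{-\infty}^\infty e^{\alpha x}\,dF(x)\in[0,\infty]$ for $\alpha\ge0$, and let $F^{*2}$ be the convolution of $F$ with itself. For $\gamma\ge0$, $F\in\mathcal{L}_\gamma$ if and only if $\overline{F}(x)>0$ for all $x$ and $\lim_{x\to\infty}\overline{F}(x-k)/\overline{F}(x)=e^{\gamma k}$ for every fixed $k\in\mathbb{R}$. For $F\in\mathcal{L}_\gamma$ write $\hat\varphi_F=\varphi_F(\gamma)$ (possibly infinite). $F\in\mathcal{S}_\gamma$ if and only if $F\in\mathcal{L}_\gamma$, $\hat\varphi_F<\infty$, and $\overline{F^{*2}}(x)\sim 2\hat\varphi_F\overline{F}(x)$ as $x\to\infty$, i.e. the ratio of the two sides tends to $1$. Random walk: $S_0=0$, $S_n=\sum_{i=1}^n\xi_i$ for $n\ge1$; $M_n=\max_{0\le i\le n}S_i$ for $n\ge0$; $M=\sup_{n\ge0}S_n$ (almost surely finite when $\gamma>0$ and $\hat\varphi_F<1$). For $x\ge a\ge0$ and $n\ge1$, $A_n^{a,x}=\{M_{n-1}\le a,\ S_n>x\}$; thus $A_n^{h(x),x-h(x)}=\{M_{n-1}\le h(x),\ S_n>x-h(x)\}$. *)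

theory Defs
  imports "HOL-Probability.Probability"
begin

definition distribution_function :: "(real \<Rightarrow> real) \<Rightarrow> bool" where
  "distribution_function F \<longleftrightarrow>
     mono F \<and> (\<forall>a. continuous (at_right a) F) \<and> (F \<longlongrightarrow> 0) at_bot \<and> (F \<longlongrightarrow> 1) at_top"

definition tail :: "(real \<Rightarrow> real) \<Rightarrow> real \<Rightarrow> real" where
  "tail F x = 1 - F x"

text \<open>Integration against dF is integration against the Lebesgue--Stieltjes measure
  \<^term>\<open>interval_measure F\<close>.\<close>

definition mgf :: "(real \<Rightarrow> real) \<Rightarrow> real \<Rightarrow> ennreal" where
  "mgf F \<alpha> = (\<integral>\<^sup>+ x. ennreal (exp (\<alpha> * x)) \<partial>interval_measure F)"

definition conv_df :: "(real \<Rightarrow> real) \<Rightarrow> (real \<Rightarrow> real) \<Rightarrow> real \<Rightarrow> real" where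
  "conv_df F G = cdf (convolution (interval_measure F) (interval_measure G))"

definition class_L :: "real \<Rightarrow> (real \<Rightarrow> real) set" where
  "class_L \<gamma> = {F. distribution_function F \<and> (\<forall>x. tail F x > 0) \<and>
     (\<forall>k. ((\<lambda>x. tail F (x - k) / tail F x) \<longlongrightarrow> exp (\<gamma> * k)) at_top)}"

definition class_S :: "real \<Rightarrow> (real \<Rightarrow> real) set" where
  "class_S \<gamma> = {F. F \<in> class_L \<gamma> \<and> mgf F \<gamma> < \<infinity> \<and>
     ((\<lambda>x. tail (conv_df F F) x / (2 * enn2real (mgf F \<gamma>) * tail F x)) \<longlongrightarrow> 1) at_top}"

text \<open>The increments are indexed from 1; the value \<^term>\<open>\<xi> 0\<close> is never used.\<close>

definition walk :: "(nat \<Rightarrow> 'a \<Rightarrow> real) \<Rightarrow> nat \<Rightarrow> 'a \<Rightarrow> real" where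
  "walk \<xi> n \<omega> = (\<Sum>i=1..n. \<xi> i \<omega>)"

definition walk_max :: "(nat \<Rightarrow> 'a \<Rightarrow> real) \<Rightarrow> nat \<Rightarrow> 'a \<Rightarrow> real" where
  "walk_max \<xi> n \<omega> = Max ((\<lambda>i. walk \<xi> i \<omega>) ` {0..n})"

text \<open>The supremum over all times is taken in \<^typ>\<open>ereal\<close>, so that it is meaningful
  also on the null set where it is infinite.\<close>

definition walk_max_ext :: "(nat \<Rightarrow> 'a \<Rightarrow> real) \<Rightarrow> enat \<Rightarrow> 'a \<Rightarrow> ereal" where
  "walk_max_ext \<xi> N \<omega> =
     (case N of enat n \<Rightarrow> ereal (walk_max \<xi> n \<omega>) | \<infinity> \<Rightarrow> (SUP n. ereal (walk \<xi> n \<omega>)))"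

definition walk_event :: "'a measure \<Rightarrow> (nat \<Rightarrow> 'a \<Rightarrow> real) \<Rightarrow> nat \<Rightarrow> real \<Rightarrow> real \<Rightarrow> 'a set" where
  "walk_event P \<xi> n a x = {\<omega> \<in> space P. walk_max \<xi> (n - 1) \<omega> \<le> a \<and> walk \<xi> n \<omega> > x}"

definition exp_ereal :: "ereal \<Rightarrow> ennreal" where
  "exp_ereal y = (case y of ereal r \<Rightarrow> ennreal (exp r) | PInfty \<Rightarrow> \<infinity> | MInfty \<Rightarrow> 0)"

definition exp_moment_max :: "'a measure \<Rightarrow> (nat \<Rightarrow> 'a \<Rightarrow> real) \<Rightarrow> real \<Rightarrow> enat \<Rightarrow> ennreal" where
  "exp_moment_max P \<xi> \<gamma> N = (\<integral>\<^sup>+ \<omega>. exp_ereal (ereal \<gamma> * walk_max_ext \<xi> N \<omega>) \<partial>P)"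

definition limit_const ::
  "'a measure \<Rightarrow> (nat \<Rightarrow> 'a \<Rightarrow> real) \<Rightarrow> (real \<Rightarrow> real) \<Rightarrow> real \<Rightarrow> enat \<Rightarrow> ennreal" where
  "limit_const P \<xi> F \<gamma> N =
     (case N of
        enat m \<Rightarrow> (\<Sum>n=1..m. mgf F \<gamma> ^ (n - 1) * exp_moment_max P \<xi> \<gamma> (enat (m - n)))
      | \<infinity> \<Rightarrow> (\<Sum>n. mgf F \<gamma> ^ n * exp_moment_max P \<xi> \<gamma> \<infinity>))"

end

theory Submission
  imports Defs
begin

text \<open>
  Write $T$ for the tail of $F$, $\varphi$ for its exponential moment at $\gamma$, and $M_N$ for the
  maximum up to time $N \le \infty$. Both probabilities are nondecreasing in $N$, and so are the
  limits, which converge to the one at $N = \infty$; hence it is enough to prove convergence for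
  each fixed $N \le \infty$. As the first probability is at most the second, this needs only an
  upper bound for the second and a lower bound for the first.

  Upper bound: for $x \ge 0$, $M_{N+1}$ exceeds $x$ iff $\xi + M_N$ does, where $\xi$ is the first
  step and $M_N$ is independent of it. Splitting at $\xi \le x - A$ and $\xi > x - A$, the second
  part has probability $E\, T(x - \min(M_N, A))$, which is asymptotic to
  $E e^{\gamma \min(M_N, A)}\, T(x)$ by dominated convergence. Membership in the class S says, by the
  same splitting with $M_N$ replaced by an independent copy of $\xi$, that
  $\int_{y \le x - A} T(x-y)\, dF(y)$ is at most about $\varphi\, T(x)$ for large $A$. So if
  $P(M_N > x)$ is asymptotically at most $l\, T(x)$, then $P(M_{N+1} > x)$ is asymptotically at most
  $(\varphi l + E e^{\gamma M_N})\, T(x)$. For $N = \infty$ the recursion is iterated from a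
  crude bound $P(M > x) \le K\, T(x)$, which the same splitting gives by induction over finite $N$.

  Lower bound: the events $A_n$ are disjoint since $h(x) \le x/2$, and on each of them one may
  replace $h(x)$ by a constant $A$, condition on everything but the $n$-th step, and apply
  dominated convergence before letting $A$ grow.
\<close>

subsection \<open>Truncation and exponentials of extended reals\<close>

text \<open>Real-valued, so that it can enter \<open>exp\<close> and the tail function. At
  \<open>- \<infinity>\<close> it has the default value 0, which is why the facts below exclude that
  point.\<close>

definition trunc :: "real \<Rightarrow> ereal \<Rightarrow> real" where
  "trunc A m = real_of_ereal (min m (ereal A))"

lemma trunc_measurable [measurable]: "trunc A \<in> borel_measurable borel"
  unfolding trunc_def by measurable

lemma trunc_le: "m \<noteq> - \<infinity> \<Longrightarrow> trunc A m \<le> A"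
  unfolding trunc_def by (cases m) (auto simp: min_def)

text \<open>The point of truncating: a large step y > x - A together with a total above x becomes
  one inequality, whose probability can be computed by integrating over y first.\<close>

lemma less_add_trunc_iff: "m \<noteq> - \<infinity> \<Longrightarrow> x < y + trunc A m \<longleftrightarrow> x - A < y \<and> ereal (x - y) < m"
  unfolding trunc_def by (cases m) (auto simp: min_def)

lemma trunc_eq: "m \<le> A \<Longrightarrow> trunc A (ereal m) = m"
  by (simp add: trunc_def min_def)

lemma exp_ereal_measurable [measurable]: "exp_ereal \<in> borel_measurable borel"
proof -
  have *: "exp_ereal = (\<lambda>y. if y = \<infinity> then \<infinity> else if y = -\<infinity> then 0 else ennreal (exp (real_of_ereal y)))"
    by (auto simp: exp_ereal_def fun_eq_iff split: ereal.splits)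
  show ?thesis by (subst *) measurable
qed

lemma exp_ereal_simps [simp]:
  "exp_ereal (ereal r) = ennreal (exp r)" "exp_ereal \<infinity> = \<infinity>" "exp_ereal (-\<infinity>) = 0"
  by (auto simp: exp_ereal_def simp flip: uminus_ereal.simps infinity_ereal_def)

lemma exp_ereal_mono: "x \<le> y \<Longrightarrow> exp_ereal x \<le> exp_ereal y"
  by (cases x; cases y) (auto simp: ennreal_leI)

lemma exp_trunc_le:
  assumes "\<gamma> > 0" "m \<noteq> - \<infinity>"
  shows "ennreal (exp (\<gamma> * trunc A m)) \<le> exp_ereal (ereal \<gamma> * m)"
  using assms unfolding trunc_def by (cases m) (auto simp: min_def ennreal_leI)

subsection \<open>Random walk on sequence space\<close>

text \<open>A single supremum for finite and infinite N lets later arguments treat both horizons at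
  once.\<close>

lemma walk_max_ext_SUP: "walk_max_ext \<xi> N \<omega> = (SUP n\<in>{n. enat n \<le> N}. ereal (walk \<xi> n \<omega>))"
proof (cases N)
  case (enat m)
  have "ereal (walk_max \<xi> m \<omega>) \<in> (\<lambda>n. ereal (walk \<xi> n \<omega>)) ` {n. enat n \<le> N}"
  proof -
    have "walk_max \<xi> m \<omega> \<in> (\<lambda>i. walk \<xi> i \<omega>) ` {0..m}"
      unfolding walk_max_def by (rule Max_in) auto
    then show ?thesis by (auto simp: enat)
  qed
  moreover have "ereal (walk \<xi> n \<omega>) \<le> ereal (walk_max \<xi> m \<omega>)" if "n \<le> m" for n
    using that by (simp add: walk_max_def)
  ultimately show ?thesis
    by (auto simp: walk_max_ext_def enat intro!: antisym SUP_least Sup_upper)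
qed (simp add: walk_max_ext_def)

lemma less_walk_max_ext_iff: "ereal x < walk_max_ext \<xi> N \<omega> \<longleftrightarrow> (\<exists>n. enat n \<le> N \<and> x < walk \<xi> n \<omega>)"
  by (auto simp: walk_max_ext_SUP less_SUP_iff)

lemma walk_max_le_iff: "walk_max \<xi> n \<omega> \<le> a \<longleftrightarrow> (\<forall>i\<le>n. walk \<xi> i \<omega> \<le> a)"
  unfolding walk_max_def by (subst Max_le_iff) auto

lemma walk_max_ext_mono: "N \<le> N' \<Longrightarrow> walk_max_ext \<xi> N \<omega> \<le> walk_max_ext \<xi> N' \<omega>"
  unfolding walk_max_ext_SUP by (rule SUP_subset_mono) auto

lemma walk_max_ext_nonneg: "0 \<le> walk_max_ext \<xi> N \<omega>"
  unfolding walk_max_ext_SUP by (rule SUP_upper2[of 0]) (auto simp: walk_def zero_enat_def[symmetric])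

lemma walk_max_ext_not_MInf: "walk_max_ext \<xi> N \<omega> \<noteq> - \<infinity>"
  using walk_max_ext_nonneg[of \<xi> N \<omega>] by auto

lemma walk_max_ext_infinity: "walk_max_ext \<xi> \<infinity> \<omega> = (SUP n. walk_max_ext \<xi> (enat n) \<omega>)"
proof (rule antisym)
  show "walk_max_ext \<xi> \<infinity> \<omega> \<le> (SUP n. walk_max_ext \<xi> (enat n) \<omega>)"
    unfolding walk_max_ext_SUP[of \<xi> \<infinity>]
  proof (rule SUP_least)
    fix n show "ereal (walk \<xi> n \<omega>) \<le> (SUP n. walk_max_ext \<xi> (enat n) \<omega>)"
      by (rule SUP_upper2[of n]) (auto simp: walk_max_ext_SUP intro!: SUP_upper)
  qed
qed (auto intro!: SUP_least walk_max_ext_mono)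

text \<open>For r > 0, exceeding r after exponentiation means exceeding
  \<open>ln r / \<gamma>\<close> before it, and a supremum exceeds a level iff one of its members
  does.\<close>

lemma exp_ereal_mult_SUP:
  assumes "\<gamma> > 0"
  shows "exp_ereal (ereal \<gamma> * (SUP i\<in>I. f i)) = (SUP i\<in>I. exp_ereal (ereal \<gamma> * f i))"
proof (rule antisym)
  show "(SUP i\<in>I. exp_ereal (ereal \<gamma> * f i)) \<le> exp_ereal (ereal \<gamma> * (SUP i\<in>I. f i))"
    using assms by (intro SUP_least exp_ereal_mono ereal_mult_left_mono SUP_upper) auto
  show "exp_ereal (ereal \<gamma> * (SUP i\<in>I. f i)) \<le> (SUP i\<in>I. exp_ereal (ereal \<gamma> * f i))"
  proof (rule dense_le)
    fix c assume c: "c < exp_ereal (ereal \<gamma> * (SUP i\<in>I. f i))"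
    then obtain r where r: "c = ennreal r" "0 \<le> r" by (cases c) auto
    show "c \<le> (SUP i\<in>I. exp_ereal (ereal \<gamma> * f i))"
    proof (cases "r = 0")
      case False
      have ln: "r < exp t \<longleftrightarrow> ln r < t" for t
        using r False by (metis exp_less_cancel_iff exp_ln less_eq_real_def)
      have iff: "c < exp_ereal (ereal \<gamma> * y) \<longleftrightarrow> ereal (ln r / \<gamma>) < y" for y
        using assms r False
        by (cases y) (auto simp: ennreal_less_iff pos_divide_less_eq mult.commute ln)
      from c obtain i where "i \<in> I" "ereal (ln r / \<gamma>) < f i"
        unfolding iff less_SUP_iff by auto
      then show ?thesis
        unfolding iff[symmetric] by (auto intro: SUP_upper2 less_imp_le)
    qed (simp add: r)
  qed
qed

lemma (in pair_prob_space) measure_pair_eq_integral: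
  assumes [measurable]: "E \<in> sets (M1 \<Otimes>\<^sub>M M2)"
  shows "measure (M1 \<Otimes>\<^sub>M M2) E = (\<integral>x. measure M2 {y \<in> space M2. (x, y) \<in> E} \<partial>M1)"
proof -
  have "measure (M1 \<Otimes>\<^sub>M M2) E = (\<integral>p. indicator E p \<partial>(M1 \<Otimes>\<^sub>M M2))"
    by (simp add: sets.Int_space_eq2)
  also have "\<dots> = (\<integral>x. \<integral>y. indicator E (x, y) \<partial>M2 \<partial>M1)"
    by (rule integral_fst'[symmetric], rule integrable_const_bound[where B=1]) auto
  also have "\<dots> = (\<integral>x. measure M2 {y \<in> space M2. (x, y) \<in> E} \<partial>M1)"
  proof (rule Bochner_Integration.integral_cong[OF refl])
    fix x assume "x \<in> space M1"
    then have "(\<integral>y. indicator E (x, y) \<partial>M2) = (\<integral>y. indicat_real {y \<in> space M2. (x, y) \<in> E} y \<partial>M2)"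
      by (intro Bochner_Integration.integral_cong) (auto simp: indicator_def)
    then show "(\<integral>y. indicator E (x, y) \<partial>M2) = measure M2 {y \<in> space M2. (x, y) \<in> E}"
      by (simp add: Int_absorb2 Collect_restrict)
  qed
  finally show ?thesis .
qed

text \<open>Shifted by one: increments are indexed from 1, sequences from 0.\<close>

definition incr :: "nat \<Rightarrow> (nat \<Rightarrow> real) \<Rightarrow> real" where
  "incr i s = s (i - 1)"

lemma walk_incr: "walk incr n s = (\<Sum>i<n. s i)"
  unfolding walk_def incr_def by (rule sum.reindex_bij_witness[of _ Suc "\<lambda>i. i - 1"]) auto

lemma walk_incr_0 [simp]: "walk incr 0 s = 0"
  by (simp add: walk_incr)

lemma walk_incr_case_nat [simp]: "walk incr (Suc n) (case_nat y s) = y + walk incr n s"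
  by (simp add: walk_incr sum.lessThan_Suc_shift del: sum.lessThan_Suc)

lemma walk_incr_comb_seq: "i \<le> n \<Longrightarrow> walk incr i (comb_seq n s t) = walk incr i s"
  unfolding walk_incr by (intro sum.cong) (auto simp: comb_seq_less)

text \<open>\<open>comb_seq n s t\<close> takes the first n terms from s and then runs through t, so
  the walk of t starts afresh from the endpoint reached at time n.\<close>

lemma walk_incr_comb_seq_add: "walk incr (n + k) (comb_seq n s t) = walk incr n s + walk incr k t"
proof -
  have "(\<Sum>i<n + k. comb_seq n s t i) = (\<Sum>i<n. comb_seq n s t i) + (\<Sum>i<k. comb_seq n s t (i + n))"
    by (induction k) (auto simp: add.commute)
  then show ?thesis by (simp add: walk_incr comb_seq_less comb_seq_add)
qed

text \<open>The pathwise first-step recursion. A level x \<ge> 0 is not exceeded at time 0, so every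
  exceedance includes the first step y and is completed by a path of s. Because
  \<open>eSuc \<infinity> = \<infinity>\<close>, the infinite horizon is covered too.\<close>

lemma less_walk_max_ext_case_nat:
  assumes "0 \<le> x"
  shows "ereal x < walk_max_ext incr (eSuc N) (case_nat y s) \<longleftrightarrow> ereal (x - y) < walk_max_ext incr N s"
proof
  assume "ereal x < walk_max_ext incr (eSuc N) (case_nat y s)"
  then obtain n where n: "enat n \<le> eSuc N" "x < walk incr n (case_nat y s)"
    by (auto simp: less_walk_max_ext_iff)
  then obtain m where "n = Suc m" using assms by (cases n) auto
  with n show "ereal (x - y) < walk_max_ext incr N s"
    by (auto simp: less_walk_max_ext_iff eSuc_enat[symmetric] intro!: exI[of _ m])
next
  assume "ereal (x - y) < walk_max_ext incr N s"
  then obtain m where "enat m \<le> N" "x - y < walk incr m s"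
    by (auto simp: less_walk_max_ext_iff)
  then show "ereal x < walk_max_ext incr (eSuc N) (case_nat y s)"
    by (auto simp: less_walk_max_ext_iff eSuc_enat[symmetric] intro!: exI[of _ "Suc m"])
qed

lemma ennreal_le_suminf:
  fixes f :: "nat \<Rightarrow> ennreal"
  shows "f n \<le> suminf f"
  using sum_le_suminf[OF summableI, of "{n}" f] by simp

text \<open>The path s takes n steps from \<omega>, the jump y as step \<open>Suc n\<close>, and
  then follows t. By \<open>less_add_trunc_iff\<close> the jump already lifts the walk above x - A,
  and some partial sum of t carries it above x.\<close>

lemma last_jump_comb_seq:
  assumes "walk_max incr n \<omega> \<le> A" and "x < (y + walk incr n \<omega>) + trunc A (walk_max_ext incr K t)"
  defines "s \<equiv> comb_seq n \<omega> (case_nat y t)"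
  shows "walk_max incr n s \<le> A" "x - A < walk incr (Suc n) s"
    "ereal x < walk_max_ext incr (enat (Suc n) + K) s"
proof -
  show "walk_max incr n s \<le> A"
    using assms(1) by (auto simp: walk_max_le_iff s_def walk_incr_comb_seq)
  have *: "x - A < y + walk incr n \<omega>" "ereal (x - (y + walk incr n \<omega>)) < walk_max_ext incr K t"
    using iffD1[OF less_add_trunc_iff[OF walk_max_ext_not_MInf] assms(2)] by simp_all
  have "walk incr (n + Suc 0) s = walk incr n \<omega> + y"
    unfolding s_def walk_incr_comb_seq_add by simp
  with *(1) show "x - A < walk incr (Suc n) s" by simp
  obtain k where k: "enat k \<le> K" "x - (y + walk incr n \<omega>) < walk incr k t"
    using *(2) by (auto simp: less_walk_max_ext_iff)
  have "walk incr (n + Suc k) s = walk incr n \<omega> + (y + walk incr k t)"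
    unfolding s_def walk_incr_comb_seq_add by simp
  moreover have "enat (n + Suc k) \<le> enat (Suc n) + K"
    using add_left_mono[OF k(1), of "enat (Suc n)"] by simp
  ultimately show "ereal x < walk_max_ext incr (enat (Suc n) + K) s"
    using k(2) unfolding less_walk_max_ext_iff by (intro exI[of _ "n + Suc k"]) simp
qed

section \<open>Uniformity in N, and reduction to the product space\<close>

text \<open>A Dini-type argument: beyond a suitable n the limits hardly vary, and monotonicity traps
  every N \<ge> n between n and \<open>\<infinity>\<close>. So finitely many pointwise limits give
  uniformity.\<close>

lemma uniform_limit_monotone_enat:
  fixes g :: "'b \<Rightarrow> enat \<Rightarrow> real"
  assumes "F \<noteq> bot"
    and mono: "\<And>x N N'. 1 \<le> N \<Longrightarrow> N \<le> N' \<Longrightarrow> g x N \<le> g x N'"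
    and lim: "\<And>N. 1 \<le> N \<Longrightarrow> ((\<lambda>x. g x N) \<longlongrightarrow> C N) F"
    and C_lim: "(\<lambda>n. C (enat n)) \<longlonglongrightarrow> C \<infinity>"
  shows "uniform_limit {1..} g C F"
  unfolding uniform_limit_iff
proof (intro allI impI)
  fix e :: real assume "e > 0"
  have C_mono: "C N \<le> C N'" if "1 \<le> N" "N \<le> N'" for N N'
    by (rule tendsto_le[OF \<open>F \<noteq> bot\<close> lim lim]) (use that mono in auto)
  have "\<forall>\<^sub>F n in sequentially. C \<infinity> - e / 3 < C (enat n) \<and> 1 \<le> n"
    using \<open>e > 0\<close> by (intro eventually_conj order_tendstoD[OF C_lim] eventually_ge_at_top) simp
  then obtain n where n: "C \<infinity> - e / 3 < C (enat n)" "1 \<le> n"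
    using eventually_happens by force
  let ?I = "insert \<infinity> (enat ` {1..n})"
  have one: "1 \<le> N" if "N \<in> ?I" for N
    using that by (auto simp: one_enat_def)
  have "\<forall>\<^sub>F x in F. \<forall>N\<in>?I. dist (g x N) (C N) < e / 3"
    using \<open>e > 0\<close> one by (intro eventually_ball_finite ballI tendstoD[OF lim]) auto
  then show "\<forall>\<^sub>F x in F. \<forall>N\<in>{1..}. dist (g x N) (C N) < e"
  proof eventually_elim
    case (elim x)
    show ?case
    proof
      fix N :: enat assume N: "N \<in> {1..}"
      show "dist (g x N) (C N) < e"
      proof (cases "N \<le> enat n")
        case True
        then have "N \<in> ?I" using N by (cases N) (auto simp: one_enat_def)
        with elim have "dist (g x N) (C N) < e / 3" by blast
        with \<open>e > 0\<close> show ?thesis by simp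
      next
        case False
        then have nN: "enat n \<le> N" by simp
        have n1: "1 \<le> enat n" using n by (simp add: one_enat_def)
        have "dist (g x (enat n)) (C (enat n)) < e / 3" "dist (g x \<infinity>) (C \<infinity>) < e / 3"
          using elim n by auto
        \<comment> \<open>The deviation at N is at most the error at n or at
          \<open>\<infinity>\<close>, below e / 3, plus the variation of C between them, again below
          e / 3.\<close>
        moreover have "g x (enat n) \<le> g x N" "g x N \<le> g x \<infinity>" "C (enat n) \<le> C N" "C N \<le> C \<infinity>"
          using nN n1 N by (auto intro!: mono C_mono)
        ultimately show ?thesis
          using n(1) unfolding dist_real_def by linarith
      qed
    qed
  qed
qed

text \<open>Allows all computations to be made under the product measure. The family starts at index
  1, hence the renumbering by \<open>Suc\<close>.\<close>

lemma (in prob_space) distr_shifted_iid: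
  fixes \<xi> :: "nat \<Rightarrow> 'a \<Rightarrow> real"
  assumes indep: "indep_vars (\<lambda>_. borel) \<xi> {1..}"
    and distr: "\<And>n. n \<ge> 1 \<Longrightarrow> distr M borel (\<xi> n) = \<mu>"
    and \<mu>: "prob_space \<mu>" "sets \<mu> = sets borel"
  shows "(\<lambda>\<omega> i. \<xi> (Suc i) \<omega>) \<in> M \<rightarrow>\<^sub>M Pi\<^sub>M UNIV (\<lambda>_. \<mu>)"
    and "distr M (Pi\<^sub>M UNIV (\<lambda>_. \<mu>)) (\<lambda>\<omega> i. \<xi> (Suc i) \<omega>) = Pi\<^sub>M UNIV (\<lambda>_. \<mu>)"
proof -
  have rv [measurable]: "\<xi> n \<in> borel_measurable M" if "n \<in> {1..}" for n
    using indep that by (auto simp: indep_vars_def)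
  have rv': "\<xi> (Suc n) \<in> M \<rightarrow>\<^sub>M \<mu>" for n
    by (subst measurable_cong_sets[OF refl \<mu>(2)]) (rule rv, simp)
  then show meas: "(\<lambda>\<omega> i. \<xi> (Suc i) \<omega>) \<in> M \<rightarrow>\<^sub>M Pi\<^sub>M UNIV (\<lambda>_. \<mu>)"
    by (intro measurable_PiM_single') (auto simp: space_PiM dest: measurable_space)
  have sets: "sets (Pi\<^sub>M {1::nat..} (\<lambda>_. borel :: real measure)) = sets (Pi\<^sub>M {1..} (\<lambda>_. \<mu>))"
    by (intro sets_PiM_cong) (auto simp: \<mu>)
  let ?R = "\<lambda>\<omega>. \<lambda>n\<in>{1::nat..}. \<xi> n \<omega>"
  let ?f = "\<lambda>(s :: nat \<Rightarrow> real). \<lambda>n\<in>(UNIV :: nat set). s (Suc n)"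
  have "distr M (Pi\<^sub>M {1..} (\<lambda>_. borel)) ?R = Pi\<^sub>M {1..} (\<lambda>i. distr M borel (\<xi> i))"
    using indep_vars_iff_distr_eq_PiM'[of "{1..}" \<xi> "\<lambda>_. borel"] indep rv by simp
  also have "\<dots> = Pi\<^sub>M {1..} (\<lambda>_. \<mu>)"
    by (intro PiM_cong) (auto simp: distr)
  finally have R: "distr M (Pi\<^sub>M {1..} (\<lambda>_. \<mu>)) ?R = Pi\<^sub>M {1..} (\<lambda>_. \<mu>)"
    using distr_cong[OF refl sets, of M ?R ?R] by simp
  have R_meas: "?R \<in> M \<rightarrow>\<^sub>M Pi\<^sub>M {1..} (\<lambda>_. \<mu>)"
    unfolding measurable_cong_sets[OF refl sets[symmetric]] using rv by (intro measurable_restrict)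
  have f_meas: "?f \<in> Pi\<^sub>M {1..} (\<lambda>_. \<mu>) \<rightarrow>\<^sub>M Pi\<^sub>M UNIV (\<lambda>_. \<mu>)"
    by (intro measurable_restrict measurable_component_singleton) auto
  \<comment> \<open>Reading the coordinates of a product of copies of \<mu> along an injection gives
    a product of copies of \<mu> again.\<close>
  have "Pi\<^sub>M UNIV (\<lambda>_. \<mu>) = distr (Pi\<^sub>M {1..} (\<lambda>_. \<mu>)) (Pi\<^sub>M UNIV (\<lambda>_. \<mu>)) ?f"
    using distr_PiM_reindex[of "{1..}" "\<lambda>_. \<mu>" Suc UNIV] \<mu>(1) by auto
  also have "\<dots> = distr M (Pi\<^sub>M UNIV (\<lambda>_. \<mu>)) (?f \<circ> ?R)"
    using distr_distr[OF f_meas R_meas] R by simp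
  also have "?f \<circ> ?R = (\<lambda>\<omega> i. \<xi> (Suc i) \<omega>)"
    by (auto simp: fun_eq_iff)
  finally show "distr M (Pi\<^sub>M UNIV (\<lambda>_. \<mu>)) (\<lambda>\<omega> i. \<xi> (Suc i) \<omega>) = Pi\<^sub>M UNIV (\<lambda>_. \<mu>)" ..
qed

subsection \<open>Convolution with a tail in the class S\<close>

text \<open>The hypotheses on F are recast for its measure \<mu> and a real number \<phi>, so that
  product measures and real arithmetic apply directly.\<close>

locale light_tail = real_distribution \<mu> for \<mu> +
  fixes \<gamma> \<phi> :: real
  assumes gamma_pos: "\<gamma> > 0"
    and tail_pos: "\<And>x. tail (cdf \<mu>) x > 0"
    and tail_ratio: "\<And>k. ((\<lambda>x. tail (cdf \<mu>) (x - k) / tail (cdf \<mu>) x) \<longlongrightarrow> exp (\<gamma> * k)) at_top"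
    and phi_nonneg: "0 \<le> \<phi>" and phi_less_1: "\<phi> < 1"
    and mgf_eq: "(\<integral>\<^sup>+ x. ennreal (exp (\<gamma> * x)) \<partial>\<mu>) = ennreal \<phi>"
    and tail_conv: "((\<lambda>x. tail (cdf (convolution \<mu> \<mu>)) x / (2 * \<phi> * tail (cdf \<mu>) x)) \<longlongrightarrow> 1) at_top"
begin

abbreviation T :: "real \<Rightarrow> real" where "T \<equiv> tail (cdf \<mu>)"

lemma tail_eq: "T x = measure \<mu> {x<..}"
proof -
  have "measure \<mu> (space \<mu> - {..x}) = 1 - measure \<mu> {..x}"
    by (rule prob_compl) auto
  moreover have "space \<mu> - {..x} = {x<..}" by auto
  ultimately show ?thesis by (simp add: tail_def cdf_def)
qed

lemma tail_antimono: "x \<le> y \<Longrightarrow> T y \<le> T x"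
  by (simp add: tail_def cdf_nondecreasing)

lemma tail_le_1: "T x \<le> 1"
  by (simp add: tail_def cdf_nonneg)

lemma tail_measurable [measurable]: "T \<in> borel_measurable borel"
proof -
  have "cdf \<mu> \<in> borel_measurable borel"
    by (rule borel_measurable_mono) (auto simp: mono_def cdf_nondecreasing)
  then show ?thesis unfolding tail_def[abs_def] by simp
qed

text \<open>The integral is cut at y = x - A. By \<open>less_add_trunc_iff\<close> the part above
  the cut is the probability of x < y + \<open>trunc A (M \<omega>)\<close>, and Fubini with y
  integrated first turns it into an expected tail. It is used both for the maximum and for a copy of
  the step.\<close>

lemma integral_tail_split:
  assumes "prob_space Q" and [measurable]: "M \<in> borel_measurable Q"
    and M: "\<And>\<omega>. M \<omega> \<noteq> - \<infinity>"
  shows "(\<integral>y. measure Q {\<omega> \<in> space Q. ereal (x - y) < M \<omega>} \<partial>\<mu>) =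
    (\<integral>y. indicator {..x - A} y * measure Q {\<omega> \<in> space Q. ereal (x - y) < M \<omega>} \<partial>\<mu>) +
    (\<integral>\<omega>. T (x - trunc A (M \<omega>)) \<partial>Q)"
proof -
  interpret Q: prob_space Q by fact
  interpret P: pair_prob_space \<mu> Q ..
  define G where "G y = measure Q {\<omega> \<in> space Q. ereal (x - y) < M \<omega>}" for y
  let ?E = "{p \<in> space (\<mu> \<Otimes>\<^sub>M Q). x < fst p + trunc A (M (snd p))}"
  have [measurable]: "?E \<in> sets (\<mu> \<Otimes>\<^sub>M Q)" by measurable
  have "(\<integral>\<omega>. (\<integral>y. indicat_real ?E (y, \<omega>) \<partial>\<mu>) \<partial>Q) = (\<integral>y. (\<integral>\<omega>. indicat_real ?E (y, \<omega>) \<partial>Q) \<partial>\<mu>)"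
  proof (rule P.Fubini_integral)
    have "integrable (\<mu> \<Otimes>\<^sub>M Q) (indicat_real ?E)"
      by (rule P.integrable_const_bound[where B=1]) auto
    then show "integrable (\<mu> \<Otimes>\<^sub>M Q) (\<lambda>(y, \<omega>). indicat_real ?E (y, \<omega>))"
      by (simp add: case_prod_eta)
  qed
  also have "(\<integral>\<omega>. (\<integral>y. indicat_real ?E (y, \<omega>) \<partial>\<mu>) \<partial>Q) = (\<integral>\<omega>. T (x - trunc A (M \<omega>)) \<partial>Q)"
  proof (rule Bochner_Integration.integral_cong[OF refl])
    fix \<omega> assume "\<omega> \<in> space Q"
    then have "(\<lambda>y. indicator ?E (y, \<omega>)) = (indicator {x - trunc A (M \<omega>)<..} :: real \<Rightarrow> real)"
      by (auto simp: fun_eq_iff indicator_def space_pair_measure)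
    then show "(\<integral>y. indicat_real ?E (y, \<omega>) \<partial>\<mu>) = T (x - trunc A (M \<omega>))"
      by (simp add: tail_eq)
  qed
  also have "(\<integral>y. (\<integral>\<omega>. indicat_real ?E (y, \<omega>) \<partial>Q) \<partial>\<mu>) = (\<integral>y. indicator {x - A<..} y * G y \<partial>\<mu>)"
  proof (rule Bochner_Integration.integral_cong[OF refl])
    fix y
    have "(\<integral>\<omega>. indicat_real ?E (y, \<omega>) \<partial>Q) = (\<integral>\<omega>. indicator {x - A<..} y * indicator {\<omega> \<in> space Q. ereal (x - y) < M \<omega>} \<omega> \<partial>Q)"
      by (intro Bochner_Integration.integral_cong[OF refl])
        (auto simp: indicator_def space_pair_measure less_add_trunc_iff[OF M])
    then show "(\<integral>\<omega>. indicat_real ?E (y, \<omega>) \<partial>Q) = indicator {x - A<..} y * G y"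
      by (simp add: G_def Int_absorb1)
  qed
  finally have *: "(\<integral>\<omega>. T (x - trunc A (M \<omega>)) \<partial>Q) = (\<integral>y. indicator {x - A<..} y * G y \<partial>\<mu>)" .
  have [measurable]: "G \<in> borel_measurable borel"
    unfolding G_def by measurable
  have int: "integrable \<mu> (\<lambda>y. indicator S y * G y)" if [measurable]: "S \<in> sets borel" for S :: "real set"
    by (rule integrable_const_bound[where B=1]) (auto simp: G_def indicator_def)
  have "(\<integral>y. G y \<partial>\<mu>) = (\<integral>y. indicator {..x - A} y * G y + indicator {x - A<..} y * G y \<partial>\<mu>)"
    by (intro Bochner_Integration.integral_cong[OF refl]) (auto simp: indicator_def)
  then show ?thesis
    unfolding * G_def[symmetric] by (simp add: int)
qed

text \<open>Dominated convergence: on B the ratio is at most T(x - A) / T(x), which converges and so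
  is eventually below a constant. Only an upper bound on U is involved, as the tail
  decreases.\<close>

lemma tendsto_integral_tail_ratio:
  assumes "finite_measure Q" and [measurable]: "U \<in> borel_measurable Q" "B \<in> sets Q"
    and U: "\<And>\<omega>. \<omega> \<in> B \<Longrightarrow> U \<omega> \<le> A"
  shows "((\<lambda>x. (\<integral>\<omega>. indicator B \<omega> * T (x - U \<omega>) \<partial>Q) / T x)
    \<longlongrightarrow> (\<integral>\<omega>. indicator B \<omega> * exp (\<gamma> * U \<omega>) \<partial>Q)) at_top"
proof -
  interpret Q: finite_measure Q by fact
  have ev: "\<forall>\<^sub>F x in at_top. T (x - A) / T x < exp (\<gamma> * A) + 1"
    by (rule order_tendstoD[OF tail_ratio]) simp
  have "((\<lambda>x. \<integral>\<omega>. indicator B \<omega> * (T (x - U \<omega>) / T x) \<partial>Q)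
    \<longlongrightarrow> (\<integral>\<omega>. indicator B \<omega> * exp (\<gamma> * U \<omega>) \<partial>Q)) at_top"
  proof (rule integral_dominated_convergence_at_top[where w="\<lambda>_. exp (\<gamma> * A) + 1"])
    show "AE \<omega> in Q. ((\<lambda>x. indicator B \<omega> * (T (x - U \<omega>) / T x)) \<longlongrightarrow> indicator B \<omega> * exp (\<gamma> * U \<omega>)) at_top"
      by (intro AE_I2 tendsto_intros tail_ratio)
    show "\<forall>\<^sub>F x in at_top. AE \<omega> in Q. norm (indicator B \<omega> * (T (x - U \<omega>) / T x)) \<le> exp (\<gamma> * A) + 1"
      using ev
    proof eventually_elim
      case (elim x)
      have "norm (indicator B \<omega> * (T (x - U \<omega>) / T x)) \<le> exp (\<gamma> * A) + 1" for \<omega>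
      proof (cases "\<omega> \<in> B")
        case True
        have "T (x - U \<omega>) / T x \<le> T (x - A) / T x"
          using U[OF True] tail_pos[of x] by (intro divide_right_mono tail_antimono) auto
        with elim show ?thesis
          using True tail_pos[of x] tail_pos[of "x - U \<omega>"] by (simp add: abs_of_pos)
      qed (simp add: add_nonneg_nonneg)
      then show ?case by simp
    qed
  qed measurable
  then show ?thesis by (simp add: times_divide_eq_right)
qed

text \<open>The truncated exponentials are dominated by the full one and coincide with it once A
  passes the almost surely finite value of M.\<close>

lemma tendsto_exp_moment_trunc:
  assumes "prob_space Q" and [measurable]: "M \<in> borel_measurable Q"
    and M: "\<And>\<omega>. M \<omega> \<noteq> - \<infinity>" and e: "(\<integral>\<^sup>+\<omega>. exp_ereal (ereal \<gamma> * M \<omega>) \<partial>Q) = ennreal e" "0 \<le> e"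
  shows "((\<lambda>A. \<integral>\<omega>. exp (\<gamma> * trunc A (M \<omega>)) \<partial>Q) \<longlongrightarrow> e) at_top"
    and "(\<integral>\<omega>. exp (\<gamma> * trunc A (M \<omega>)) \<partial>Q) \<le> e"
proof -
  interpret Q: prob_space Q by fact
  let ?w = "\<lambda>\<omega>. enn2real (exp_ereal (ereal \<gamma> * M \<omega>))"
  \<comment> \<open>Where M is infinite, \<open>enn2real\<close> would return 0 and domination would
    fail; the finite moment makes this a null set.\<close>
  have "AE \<omega> in Q. exp_ereal (ereal \<gamma> * M \<omega>) \<noteq> \<infinity>"
    by (rule nn_integral_PInf_AE) (auto simp: e)
  then have fin: "AE \<omega> in Q. M \<omega> \<noteq> \<infinity>"
    by eventually_elim (use gamma_pos in auto)
  have "(\<integral>\<^sup>+\<omega>. ennreal (?w \<omega>) \<partial>Q) = (\<integral>\<^sup>+\<omega>. exp_ereal (ereal \<gamma> * M \<omega>) \<partial>Q)"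
  proof (rule nn_integral_cong_AE, use fin in eventually_elim)
    case (elim \<omega>)
    then obtain r where "M \<omega> = ereal r" using M[of \<omega>] by (cases "M \<omega>") auto
    then show ?case by simp
  qed
  then have nn: "(\<integral>\<^sup>+\<omega>. ennreal (?w \<omega>) \<partial>Q) = ennreal e"
    using e by simp
  then have int: "integrable Q ?w"
    by (intro integrableI_nn_integral_finite[where x=e]) (auto simp: e)
  have w: "(\<integral>\<omega>. ?w \<omega> \<partial>Q) = e"
    by (rule integral_eq_nn_integral[THEN trans]) (auto simp: nn e)
  have le: "AE \<omega> in Q. exp (\<gamma> * trunc A (M \<omega>)) \<le> ?w \<omega>" for A
    using fin
  proof eventually_elim
    case (elim \<omega>)
    then obtain r where "M \<omega> = ereal r" using M[of \<omega>] by (cases "M \<omega>") auto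
    then show ?case using exp_trunc_le[OF gamma_pos M, of A \<omega>] by simp
  qed
  have "((\<lambda>A. \<integral>\<omega>. exp (\<gamma> * trunc A (M \<omega>)) \<partial>Q) \<longlongrightarrow> (\<integral>\<omega>. ?w \<omega> \<partial>Q)) at_top"
  proof (rule integral_dominated_convergence_at_top[OF _ _ int])
    show "\<forall>\<^sub>F A in at_top. AE \<omega> in Q. norm (exp (\<gamma> * trunc A (M \<omega>))) \<le> ?w \<omega>"
      using le by simp
    show "AE \<omega> in Q. ((\<lambda>A. exp (\<gamma> * trunc A (M \<omega>))) \<longlongrightarrow> ?w \<omega>) at_top"
      using fin
    proof eventually_elim
      case (elim \<omega>)
      then obtain r where r: "M \<omega> = ereal r" using M[of \<omega>] by (cases "M \<omega>") auto
      show ?case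
        by (rule tendsto_eventually, use eventually_ge_at_top[of r] in eventually_elim)
          (simp add: r trunc_eq)
    qed
  qed measurable
  then show "((\<lambda>A. \<integral>\<omega>. exp (\<gamma> * trunc A (M \<omega>)) \<partial>Q) \<longlongrightarrow> e) at_top"
    by (simp add: w)
  have "(\<integral>\<omega>. exp (\<gamma> * trunc A (M \<omega>)) \<partial>Q) \<le> (\<integral>\<omega>. ?w \<omega> \<partial>Q)"
    by (rule integral_mono_AE'[OF int le]) auto
  then show "(\<integral>\<omega>. exp (\<gamma> * trunc A (M \<omega>)) \<partial>Q) \<le> e" by (simp add: w)
qed

section \<open>Consequences of the convolution limit\<close>

lemma phi_pos: "0 < \<phi>"
proof (rule ccontr)
  assume "\<not> 0 < \<phi>"
  with phi_nonneg have "\<phi> = 0" by simp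
  \<comment> \<open>Division by zero gives 0, so the ratio would be constantly 0.\<close>
  with tail_conv have "((\<lambda>x::real. 0::real) \<longlongrightarrow> 1) at_top" by simp
  then show False by (simp add: tendsto_const_iff)
qed

lemma tail_convolution: "tail (cdf (convolution \<mu> \<mu>)) x = (\<integral>y. T (x - y) \<partial>\<mu>)"
proof -
  interpret P: pair_prob_space \<mu> \<mu> ..
  interpret C: prob_space "convolution \<mu> \<mu>"
    unfolding convolution_def by (rule P.prob_space_distr) simp
  have "measure (convolution \<mu> \<mu>) (space (convolution \<mu> \<mu>) - {..x}) = 1 - measure (convolution \<mu> \<mu>) {..x}"
    by (rule C.prob_compl) simp
  moreover have "space (convolution \<mu> \<mu>) - {..x} = {x<..}" by auto
  ultimately have "tail (cdf (convolution \<mu> \<mu>)) x = measure (convolution \<mu> \<mu>) {x<..}"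
    by (simp add: tail_def cdf_def)
  also have "\<dots> = enn2real (\<integral>\<^sup>+y. emeasure \<mu> {a. a + y \<in> {x<..}} \<partial>\<mu>)"
    unfolding measure_def by (subst convolution_emeasure) auto
  also have "(\<integral>\<^sup>+y. emeasure \<mu> {a. a + y \<in> {x<..}} \<partial>\<mu>) = (\<integral>\<^sup>+y. ennreal (T (x - y)) \<partial>\<mu>)"
  proof (rule nn_integral_cong)
    fix y
    have "{a. a + y \<in> {x<..}} = {x - y<..}" by auto
    then show "emeasure \<mu> {a. a + y \<in> {x<..}} = ennreal (T (x - y))"
      by (simp add: tail_eq emeasure_eq_measure)
  qed
  also have "enn2real \<dots> = (\<integral>y. T (x - y) \<partial>\<mu>)"
    by (rule integral_eq_nn_integral[symmetric]) (auto intro: less_imp_le tail_pos)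
  finally show ?thesis .
qed

text \<open>The whole convolution tail is about 2 \<phi> T(x), and for large A the part with y > x -
  A already accounts for about \<phi> T(x). The rest is the difference.\<close>

lemma eventually_truncated_convolution_le:
  assumes "\<epsilon> > 0"
  shows "\<forall>\<^sub>F A in at_top. \<forall>\<^sub>F x in at_top. (\<integral>y. indicator {..x - A} y * T (x - y) \<partial>\<mu>) \<le> (\<phi> + \<epsilon>) * T x"
proof -
  have m: "((\<lambda>A. \<integral>y. exp (\<gamma> * trunc A (ereal y)) \<partial>\<mu>) \<longlongrightarrow> \<phi>) at_top"
    by (rule tendsto_exp_moment_trunc) (auto simp: mgf_eq phi_nonneg prob_space_axioms)
  \<comment> \<open>The error is spent in thirds: on the truncated moment, on the limit in x of the
    upper part, and on the full convolution.\<close>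
  have "\<forall>\<^sub>F A in at_top. \<phi> - \<epsilon>/3 < (\<integral>y. exp (\<gamma> * trunc A (ereal y)) \<partial>\<mu>)"
    by (rule order_tendstoD[OF m]) (use assms in simp)
  then show ?thesis
  proof eventually_elim
    case (elim A)
    have "((\<lambda>x. (\<integral>y. T (x - y) \<partial>\<mu>) / (2 * \<phi> * T x) * (2 * \<phi>)) \<longlongrightarrow> 1 * (2 * \<phi>)) at_top"
      using tail_conv by (intro tendsto_intros) (simp add: tail_convolution)
    then have "((\<lambda>x. (\<integral>y. T (x - y) \<partial>\<mu>) / T x) \<longlongrightarrow> 2 * \<phi>) at_top"
      using phi_pos by (simp add: field_simps)
    then have 1: "\<forall>\<^sub>F x in at_top. (\<integral>y. T (x - y) \<partial>\<mu>) / T x < 2 * \<phi> + \<epsilon>/3"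
      by (rule order_tendstoD) (use assms in simp)
    have "((\<lambda>x. (\<integral>y. indicator UNIV y * T (x - trunc A (ereal y)) \<partial>\<mu>) / T x)
      \<longlongrightarrow> (\<integral>y. indicator UNIV y * exp (\<gamma> * trunc A (ereal y)) \<partial>\<mu>)) at_top"
      by (rule tendsto_integral_tail_ratio[where A=A]) (auto intro: trunc_le finite_measure_axioms)
    then have "\<forall>\<^sub>F x in at_top. \<phi> - 2*\<epsilon>/3 < (\<integral>y. indicator UNIV y * T (x - trunc A (ereal y)) \<partial>\<mu>) / T x"
      by (rule order_tendstoD) (use elim assms in simp)
    with 1 show ?case
    proof eventually_elim
      case (elim x)
      have "{z. x - y < z} = {x - y<..}" for y by auto
      then have "measure \<mu> {z \<in> space \<mu>. ereal (x - y) < ereal z} = T (x - y)" for y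
        by (simp add: tail_eq)
      \<comment> \<open>Here an independent copy of the step plays the role of M.\<close>
      with integral_tail_split[of \<mu> ereal x A]
      have "(\<integral>y. T (x - y) \<partial>\<mu>) = (\<integral>y. indicator {..x - A} y * T (x - y) \<partial>\<mu>) + (\<integral>y. T (x - trunc A (ereal y)) \<partial>\<mu>)"
        by (simp add: prob_space_axioms)
      moreover have "(\<integral>y. T (x - y) \<partial>\<mu>) \<le> (2 * \<phi> + \<epsilon>/3) * T x"
        "(\<phi> - 2*\<epsilon>/3) * T x \<le> (\<integral>y. T (x - trunc A (ereal y)) \<partial>\<mu>)"
        using elim tail_pos[of x] by (simp_all add: pos_divide_less_eq pos_less_divide_eq)
      ultimately show ?case by (simp add: algebra_simps)
    qed
  qed
qed

subsection \<open>Tail of the maximum: upper bounds\<close>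

sublocale Seq: sequence_space \<mu> ..

abbreviation W :: "(nat \<Rightarrow> real) measure" where "W \<equiv> Pi\<^sub>M UNIV (\<lambda>_. \<mu>)"

lemma prob_space_W: "prob_space W"
  by (rule prob_space_PiM) (rule prob_space_axioms)

lemma walk_measurable [measurable]: "walk incr n \<in> borel_measurable W"
  unfolding walk_incr[abs_def] by measurable

lemma walk_max_measurable [measurable]: "walk_max incr n \<in> borel_measurable W"
  unfolding walk_max_def[abs_def] by measurable

lemma walk_max_ext_measurable [measurable]: "walk_max_ext incr N \<in> borel_measurable W"
  unfolding walk_max_ext_SUP[abs_def] by measurable

lemma case_nat_measurable: "(\<lambda>(y, s). case_nat y s) \<in> \<mu> \<Otimes>\<^sub>M W \<rightarrow>\<^sub>M W"
  by measurable

definition max_tail :: "enat \<Rightarrow> real \<Rightarrow> real" where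
  "max_tail N x = measure W {s \<in> space W. ereal x < walk_max_ext incr N s}"

lemma max_tail_nonneg: "0 \<le> max_tail N x"
  by (simp add: max_tail_def)

lemma max_tail_le_1: "max_tail N x \<le> 1"
proof -
  show ?thesis by (simp add: max_tail_def)
qed

lemma max_tail_measurable [measurable]: "max_tail N \<in> borel_measurable borel"
proof -
  show ?thesis unfolding max_tail_def[abs_def] by measurable
qed

text \<open>Under W the first term is independent of the remaining sequence, which is again
  distributed as W. The pathwise recursion is integrated over that first term.\<close>

lemma max_tail_eSuc:
  assumes "0 \<le> x"
  shows "max_tail (eSuc N) x = (\<integral>y. max_tail N (x - y) \<partial>\<mu>)"
proof -
  interpret P: pair_prob_space \<mu> W ..
  let ?E = "{s \<in> space W. ereal x < walk_max_ext incr (eSuc N) s}"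
  have "max_tail (eSuc N) x = measure (distr (\<mu> \<Otimes>\<^sub>M W) W (\<lambda>(y, s). case_nat y s)) ?E"
    by (simp add: max_tail_def Seq.PiM_iter)
  also have "\<dots> = measure (\<mu> \<Otimes>\<^sub>M W) ((\<lambda>(y, s). case_nat y s) -` ?E \<inter> space (\<mu> \<Otimes>\<^sub>M W))"
    by (rule measure_distr) measurable
  also have "\<dots> = (\<integral>y. measure W {s \<in> space W. (y, s) \<in> (\<lambda>(y, s). case_nat y s) -` ?E \<inter> space (\<mu> \<Otimes>\<^sub>M W)} \<partial>\<mu>)"
    by (rule P.measure_pair_eq_integral) (rule measurable_sets[OF case_nat_measurable], measurable)
  also have "\<dots> = (\<integral>y. max_tail N (x - y) \<partial>\<mu>)"
    unfolding max_tail_def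
    by (intro Bochner_Integration.integral_cong[OF refl] arg_cong[where f="measure W"])
      (auto simp: less_walk_max_ext_case_nat[OF assms] space_pair_measure space_PiM)
  finally show ?thesis .
qed

lemma max_tail_split:
  assumes "0 \<le> x"
  shows "max_tail (eSuc N) x = (\<integral>y. indicator {..x - A} y * max_tail N (x - y) \<partial>\<mu>) +
    (\<integral>s. T (x - trunc A (walk_max_ext incr N s)) \<partial>W)"
  unfolding max_tail_eSuc[OF assms] unfolding max_tail_def
  by (rule integral_tail_split) (auto intro: prob_space_W simp: walk_max_ext_not_MInf)

lemma integrable_indicator_tail:
  "integrable \<mu> (\<lambda>y. indicator {..x - A} y * T (x - y))"
  by (rule integrable_const_bound[where B=1])
    (auto simp: indicator_def tail_le_1 abs_of_pos[OF tail_pos])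

text \<open>For y \<le> x - A the distance x - y left to climb is at least A, so a bound valid from
  A on suffices.\<close>

lemma max_tail_truncated_le:
  assumes "\<And>z. A \<le> z \<Longrightarrow> max_tail N z \<le> K * T z"
  shows "(\<integral>y. indicator {..x - A} y * max_tail N (x - y) \<partial>\<mu>)
    \<le> K * (\<integral>y. indicator {..x - A} y * T (x - y) \<partial>\<mu>)"
proof -
  have "(\<integral>y. indicator {..x - A} y * max_tail N (x - y) \<partial>\<mu>)
    \<le> (\<integral>y. K * (indicator {..x - A} y * T (x - y)) \<partial>\<mu>)"
  proof (rule integral_mono)
    show "integrable \<mu> (\<lambda>y. indicator {..x - A} y * max_tail N (x - y))"
      by (rule integrable_const_bound[where B=1])
        (auto simp: indicator_def max_tail_le_1 abs_of_nonneg[OF max_tail_nonneg])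
    show "indicator {..x - A} y * max_tail N (x - y) \<le> K * (indicator {..x - A} y * T (x - y))" for y
      using assms[of "x - y"] by (auto simp: indicator_def)
  qed (simp add: integrable_indicator_tail)
  then show ?thesis by simp
qed

text \<open>One K serves all finite N by induction: the truncated convolution multiplies K by some r
  < 1, and the large-step part adds a constant C. Continuity from below extends the bound to
  \<open>\<infinity>\<close>.\<close>

lemma max_tail_bounded: "\<exists>K\<ge>0. \<forall>N z. max_tail N z \<le> K * T z"
proof -
  \<comment> \<open>Halfway between \<phi> and 1, which leaves the error (1 - \<phi>) / 2 for the
    truncated convolution.\<close>
  define r where "r = (\<phi> + 1) / 2"
  have r: "0 < r" "r < 1" using phi_less_1 phi_pos by (auto simp: r_def)
  have "\<forall>\<^sub>F A in at_top. 0 \<le> A \<and> (\<forall>\<^sub>F x in at_top. (\<integral>y. indicator {..x - A} y * T (x - y) \<partial>\<mu>) \<le> (\<phi> + (1 - \<phi>) / 2) * T x)"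
    using phi_less_1 by (intro eventually_conj eventually_ge_at_top eventually_truncated_convolution_le) simp
  then obtain A where A: "0 \<le> A"
    "\<forall>\<^sub>F x in at_top. (\<integral>y. indicator {..x - A} y * T (x - y) \<partial>\<mu>) \<le> (\<phi> + (1 - \<phi>) / 2) * T x"
    using eventually_happens by force
  have "\<phi> + (1 - \<phi>) / 2 = r" by (simp add: r_def field_simps)
  note A(2)[unfolded this]
  moreover have "\<forall>\<^sub>F x in at_top. T (x - A) / T x < exp (\<gamma> * A) + 1"
    by (rule order_tendstoD[OF tail_ratio]) simp
  ultimately have "\<forall>\<^sub>F x in at_top. 0 \<le> x \<and> (\<integral>y. indicator {..x - A} y * T (x - y) \<partial>\<mu>) \<le> r * T x \<and>
      T (x - A) / T x < exp (\<gamma> * A) + 1"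
    using eventually_ge_at_top[of 0] by eventually_elim auto
  then obtain X where X: "\<And>x. x \<ge> X \<Longrightarrow> 0 \<le> x \<and> (\<integral>y. indicator {..x - A} y * T (x - y) \<partial>\<mu>) \<le> r * T x \<and>
      T (x - A) / T x < exp (\<gamma> * A) + 1"
    by (auto simp: eventually_at_top_linorder)
  define C where "C = exp (\<gamma> * A) + 1"
  have C: "C > 0" by (simp add: C_def add_pos_pos)
  \<comment> \<open>The first summand makes the bound trivial for z \<le> X, where K T(z) \<ge> 1.
    The second makes K r + C \<le> K, which closes the induction.\<close>
  define K where "K = 1 / T X + C / (1 - r)"
  have K: "K \<ge> 1 / T X" "K \<ge> C / (1 - r)" "K \<ge> 0"
    using C r tail_pos[of X] by (auto simp: K_def)
  have KC: "K * r + C \<le> K"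
    using K(2) r by (simp add: field_simps)
  have small: "1 \<le> K * T z" if "z \<le> X" for z
  proof -
    have "1 = 1 / T X * T X" using tail_pos[of X] by simp
    also have "\<dots> \<le> K * T z"
      using K tail_antimono[OF that] tail_pos[of X] by (intro mult_mono) auto
    finally show ?thesis .
  qed
  have fin: "max_tail (enat n) z \<le> K * T z" for n z
  proof (induction n arbitrary: z)
    case 0
    show ?case
    proof (cases "z \<le> X")
      case True
      then show ?thesis using small[OF True] max_tail_le_1[of "enat 0" z] by linarith
    next
      case False
      then have "0 \<le> z" using X[of z] by simp
      then have "max_tail (enat 0) z = 0"
        by (simp add: max_tail_def less_walk_max_ext_iff not_less)
      then show ?thesis using K tail_pos[of z] by simp
    qed
  next
    case (Suc n)
    show ?case
    proof (cases "z \<le> X")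
      case True
      then show ?thesis using small[OF True] max_tail_le_1[of "enat (Suc n)" z] by linarith
    next
      case False
      then have z: "0 \<le> z" "(\<integral>y. indicator {..z - A} y * T (z - y) \<partial>\<mu>) \<le> r * T z" "T (z - A) \<le> C * T z"
        using X[of z] tail_pos[of z] by (auto simp: C_def pos_divide_less_eq)
      have "max_tail (enat (Suc n)) z = (\<integral>y. indicator {..z - A} y * max_tail (enat n) (z - y) \<partial>\<mu>) +
        (\<integral>s. T (z - trunc A (walk_max_ext incr (enat n) s)) \<partial>W)"
        using max_tail_split[OF z(1), of "enat n" A] by (simp add: eSuc_enat)
      moreover have "(\<integral>y. indicator {..z - A} y * max_tail (enat n) (z - y) \<partial>\<mu>) \<le> K * (r * T z)"
        by (rule order_trans[OF max_tail_truncated_le[OF Suc.IH] mult_left_mono[OF z(2) K(3)]])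
      moreover have "(\<integral>s. T (z - trunc A (walk_max_ext incr (enat n) s)) \<partial>W) \<le> (\<integral>s. T (z - A) \<partial>W)"
      proof (rule integral_mono)
        show "integrable W (\<lambda>s. T (z - trunc A (walk_max_ext incr (enat n) s)))"
          by (rule Seq.P.integrable_const_bound[where B=1]) (auto simp: tail_le_1 abs_of_pos[OF tail_pos])
      qed (auto intro!: tail_antimono trunc_le walk_max_ext_not_MInf)
      moreover have "(\<integral>s. T (z - A) \<partial>W) = T (z - A)" by (simp add: Seq.P.prob_space)
      ultimately have "max_tail (enat (Suc n)) z \<le> K * (r * T z) + C * T z"
        using z(3) by linarith
      also have "\<dots> = (K * r + C) * T z" by (simp add: algebra_simps)
      also have "\<dots> \<le> K * T z" using KC tail_pos[of z] by simp
      finally show ?thesis .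
    qed
  qed
  have "max_tail N z \<le> K * T z" for N z
  proof (cases N)
    case infinity
    have "(\<lambda>n. max_tail (enat n) z) \<longlonglongrightarrow> measure W (\<Union>n. {s \<in> space W. ereal z < walk_max_ext incr (enat n) s})"
      unfolding max_tail_def
      by (rule Seq.P.finite_Lim_measure_incseq)
        (auto simp: incseq_def less_walk_max_ext_iff intro: order_trans)
    also have "(\<Union>n. {s \<in> space W. ereal z < walk_max_ext incr (enat n) s}) = {s \<in> space W. ereal z < walk_max_ext incr \<infinity> s}"
      by (auto simp: less_walk_max_ext_iff)
    finally show ?thesis
      using fin by (auto simp: infinity max_tail_def[of \<infinity>] intro: LIMSEQ_le_const2)
  qed (simp add: fin)
  with K(3) show ?thesis by blast
qed

section \<open>Exponential moments of the maximum\<close>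

abbreviation moment :: "enat \<Rightarrow> ennreal" where
  "moment N \<equiv> exp_moment_max W incr \<gamma> N"

lemma nn_integral_exp_walk: "(\<integral>\<^sup>+s. ennreal (exp (\<gamma> * walk incr n s)) \<partial>W) = ennreal (\<phi> ^ n)"
proof (induction n)
  case 0
  show ?case by (simp add: Seq.P.emeasure_space_1)
next
  case (Suc n)
  have "(\<integral>\<^sup>+s. ennreal (exp (\<gamma> * walk incr (Suc n) s)) \<partial>W)
    = (\<integral>\<^sup>+s. ennreal (exp (\<gamma> * walk incr (Suc n) s)) \<partial>distr (\<mu> \<Otimes>\<^sub>M W) W (\<lambda>(y, s). case_nat y s))"
    by (simp add: Seq.PiM_iter)
  also have "\<dots> = (\<integral>\<^sup>+p. ennreal (exp (\<gamma> * walk incr (Suc n) (case_nat (fst p) (snd p)))) \<partial>(\<mu> \<Otimes>\<^sub>M W))"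
    by (subst nn_integral_distr) (auto simp: case_prod_beta)
  also have "\<dots> = (\<integral>\<^sup>+p. ennreal (exp (\<gamma> * fst p)) * ennreal (exp (\<gamma> * walk incr n (snd p))) \<partial>(\<mu> \<Otimes>\<^sub>M W))"
    by (simp add: distrib_left exp_add ennreal_mult)
  also have "\<dots> = (\<integral>\<^sup>+y. \<integral>\<^sup>+s. ennreal (exp (\<gamma> * y)) * ennreal (exp (\<gamma> * walk incr n s)) \<partial>W \<partial>\<mu>)"
    by (subst Seq.P.nn_integral_fst[symmetric]) auto
  also have "\<dots> = ennreal \<phi> * ennreal (\<phi> ^ n)"
    by (simp add: nn_integral_cmult nn_integral_multc Suc mgf_eq)
  finally show ?case
    by (simp add: ennreal_mult phi_nonneg)
qed

lemma moment_mono: "N \<le> N' \<Longrightarrow> moment N \<le> moment N'"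
  unfolding exp_moment_max_def
  by (rule nn_integral_mono, rule exp_ereal_mono, rule ereal_mult_left_mono, erule walk_max_ext_mono)
    (use gamma_pos in simp)

text \<open>The exponential of a supremum is at most the sum of the exponentials of the partial sums
  of the walk, whose expectations form a geometric series with ratio \<phi> < 1.\<close>

lemma moment_finite: "moment N < \<infinity>"
proof -
  have "moment N \<le> (\<integral>\<^sup>+s. (\<Sum>n. ennreal (exp (\<gamma> * walk incr n s))) \<partial>W)"
    unfolding exp_moment_max_def
  proof (rule nn_integral_mono)
    fix s
    have *: "ennreal (exp (\<gamma> * walk incr n s)) \<le> (\<Sum>n. ennreal (exp (\<gamma> * walk incr n s)))" for n
      by (rule ennreal_le_suminf)
    have "exp_ereal (ereal \<gamma> * walk_max_ext incr N s)
      = (SUP n\<in>{n. enat n \<le> N}. exp_ereal (ereal \<gamma> * ereal (walk incr n s)))"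
      by (subst walk_max_ext_SUP) (rule exp_ereal_mult_SUP[OF gamma_pos])
    also have "\<dots> \<le> (\<Sum>n. ennreal (exp (\<gamma> * walk incr n s)))"
      by (rule SUP_least) (simp only: times_ereal.simps exp_ereal_simps *)
    finally show "exp_ereal (ereal \<gamma> * walk_max_ext incr N s) \<le> (\<Sum>n. ennreal (exp (\<gamma> * walk incr n s)))" .
  qed
  also have "\<dots> = (\<Sum>n. ennreal (\<phi> ^ n))"
    by (subst nn_integral_suminf) (auto simp: nn_integral_exp_walk)
  also have "\<dots> = ennreal (\<Sum>n. \<phi> ^ n)"
    by (rule suminf_ennreal2) (auto simp: phi_nonneg phi_less_1 intro!: summable_geometric)
  also have "\<dots> < \<infinity>" by simp
  finally show ?thesis .
qed

lemma moment_infinity: "moment \<infinity> = (SUP n. moment (enat n))"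
proof -
  have "exp_ereal (ereal \<gamma> * walk_max_ext incr \<infinity> s)
    = (SUP n. exp_ereal (ereal \<gamma> * walk_max_ext incr (enat n) s))" for s
    by (subst walk_max_ext_infinity) (rule exp_ereal_mult_SUP[OF gamma_pos])
  then have "moment \<infinity> = (\<integral>\<^sup>+s. (SUP n. exp_ereal (ereal \<gamma> * walk_max_ext incr (enat n) s)) \<partial>W)"
    by (simp only: exp_moment_max_def)
  also have "\<dots> = (SUP n. moment (enat n))"
    unfolding exp_moment_max_def
  proof (rule nn_integral_monotone_convergence_SUP)
    have "exp_ereal (ereal \<gamma> * walk_max_ext incr (enat m) s) \<le> exp_ereal (ereal \<gamma> * walk_max_ext incr (enat n) s)"
      if "m \<le> n" for m n s
      using that gamma_pos by (intro exp_ereal_mono ereal_mult_left_mono[OF walk_max_ext_mono]) auto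
    then show "incseq (\<lambda>n s. exp_ereal (ereal \<gamma> * walk_max_ext incr (enat n) s))"
      by (simp add: incseq_def le_fun_def)
  qed measurable
  finally show ?thesis .
qed

definition emom :: "enat \<Rightarrow> real" where
  "emom N = enn2real (moment N)"

lemma emom_nonneg: "0 \<le> emom N"
  by (simp add: emom_def)

lemma moment_eq: "moment N = ennreal (emom N)"
  using moment_finite[of N] by (simp add: emom_def)

lemma emom_mono: "N \<le> N' \<Longrightarrow> emom N \<le> emom N'"
  using moment_mono[of N N'] by (simp add: moment_eq ennreal_le_iff emom_nonneg)

lemma emom_tendsto: "(\<lambda>n. emom (enat n)) \<longlonglongrightarrow> emom \<infinity>"
proof -
  have "(\<lambda>n. moment (enat n)) \<longlonglongrightarrow> moment \<infinity>"
    unfolding moment_infinity by (rule LIMSEQ_SUP) (auto simp: incseq_def intro: moment_mono)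
  then show ?thesis
    unfolding moment_eq by (simp add: emom_nonneg)
qed

section \<open>Asymptotic upper bounds and the limiting constants\<close>

text \<open>Expresses that the limsup of \<open>max_tail N x / T x\<close> is at most l.\<close>

definition bound_rate :: "enat \<Rightarrow> real \<Rightarrow> bool" where
  "bound_rate N l \<longleftrightarrow> (\<forall>\<epsilon>>0. \<forall>\<^sub>F x in at_top. max_tail N x \<le> (l + \<epsilon>) * T x)"

text \<open>In \<open>max_tail_split\<close> the first part is at most about l times the truncated
  convolution, hence l \<phi> T(x), and the second at most about
  \<open>emom N * T x\<close>.\<close>

lemma bound_rate_eSuc:
  assumes N: "bound_rate N l" and "0 \<le> l"
  shows "bound_rate (eSuc N) (\<phi> * l + emom N)"
  unfolding bound_rate_def
proof (intro allI impI)
  fix \<epsilon> :: real assume eps: "\<epsilon> > 0"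
  \<comment> \<open>By continuity at 0, one small \<delta> absorbs the errors of all three
    estimates.\<close>
  have "((\<lambda>\<delta>. (l + \<delta>) * (\<phi> + \<delta>) + (emom N + \<delta>)) \<longlongrightarrow> (l + 0) * (\<phi> + 0) + (emom N + 0)) (at_right 0)"
    by (intro tendsto_intros)
  then have "\<forall>\<^sub>F \<delta> in at_right 0. (l + \<delta>) * (\<phi> + \<delta>) + (emom N + \<delta>) < \<phi> * l + emom N + \<epsilon>"
    by (rule order_tendstoD) (use eps in \<open>simp add: mult.commute\<close>)
  then have "\<forall>\<^sub>F \<delta> in at_right 0. 0 < \<delta> \<and> (l + \<delta>) * (\<phi> + \<delta>) + (emom N + \<delta>) < \<phi> * l + emom N + \<epsilon>"
    using eventually_at_right_less[of 0] by eventually_elim simp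
  then obtain \<delta> where \<delta>: "0 < \<delta>" "(l + \<delta>) * (\<phi> + \<delta>) + (emom N + \<delta>) < \<phi> * l + emom N + \<epsilon>"
    using eventually_happens by force
  \<comment> \<open>The cutoff A has to pass two thresholds: this one for the bound on
    \<open>max_tail\<close>, and one for the truncated convolution.\<close>
  have "\<forall>\<^sub>F A in at_top. \<forall>z\<ge>A. max_tail N z \<le> (l + \<delta>) * T z"
  proof -
    obtain B where "\<And>z. z \<ge> B \<Longrightarrow> max_tail N z \<le> (l + \<delta>) * T z"
      using N \<delta>(1) by (auto simp: bound_rate_def eventually_at_top_linorder)
    then show ?thesis
      by (intro eventually_at_top_linorderI[of B]) simp
  qed
  with eventually_truncated_convolution_le[OF \<delta>(1)]
  have "\<forall>\<^sub>F A in at_top. (\<forall>z\<ge>A. max_tail N z \<le> (l + \<delta>) * T z) \<and>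
      (\<forall>\<^sub>F x in at_top. (\<integral>y. indicator {..x - A} y * T (x - y) \<partial>\<mu>) \<le> (\<phi> + \<delta>) * T x)"
    by eventually_elim simp
  then obtain A where A: "\<And>z. z \<ge> A \<Longrightarrow> max_tail N z \<le> (l + \<delta>) * T z"
      "\<forall>\<^sub>F x in at_top. (\<integral>y. indicator {..x - A} y * T (x - y) \<partial>\<mu>) \<le> (\<phi> + \<delta>) * T x"
    using eventually_happens by force
  have "((\<lambda>x. (\<integral>s. indicator (space W) s * T (x - trunc A (walk_max_ext incr N s)) \<partial>W) / T x)
      \<longlongrightarrow> (\<integral>s. indicator (space W) s * exp (\<gamma> * trunc A (walk_max_ext incr N s)) \<partial>W)) at_top"
    by (rule tendsto_integral_tail_ratio[where A=A])
      (auto intro!: trunc_le walk_max_ext_not_MInf Seq.P.finite_measure_axioms)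
  then have lim: "((\<lambda>x. (\<integral>s. T (x - trunc A (walk_max_ext incr N s)) \<partial>W) / T x)
      \<longlongrightarrow> (\<integral>s. exp (\<gamma> * trunc A (walk_max_ext incr N s)) \<partial>W)) at_top"
    by (simp add: space_PiM)
  \<comment> \<open>Truncation only lowers the moment, so this bound holds at the fixed A.\<close>
  have "(\<integral>s. exp (\<gamma> * trunc A (walk_max_ext incr N s)) \<partial>W) \<le> emom N"
    by (rule tendsto_exp_moment_trunc(2))
      (auto simp: walk_max_ext_not_MInf prob_space_W emom_nonneg moment_eq[unfolded exp_moment_max_def])
  then have "\<forall>\<^sub>F x in at_top. (\<integral>s. T (x - trunc A (walk_max_ext incr N s)) \<partial>W) / T x < emom N + \<delta>"
    by (intro order_tendstoD[OF lim]) (use \<delta> in simp)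
  with A(2) eventually_ge_at_top[of 0]
  show "\<forall>\<^sub>F x in at_top. max_tail (eSuc N) x \<le> (\<phi> * l + emom N + \<epsilon>) * T x"
  proof eventually_elim
    case (elim x)
    have "(\<integral>s. T (x - trunc A (walk_max_ext incr N s)) \<partial>W) \<le> (emom N + \<delta>) * T x"
      using elim tail_pos[of x] by (simp add: pos_divide_less_eq)
    moreover have "(\<integral>y. indicator {..x - A} y * max_tail N (x - y) \<partial>\<mu>) \<le> (l + \<delta>) * ((\<phi> + \<delta>) * T x)"
      using \<delta> \<open>0 \<le> l\<close> elim
      by (intro order_trans[OF max_tail_truncated_le[OF A(1)] mult_left_mono]) auto
    ultimately have "max_tail (eSuc N) x \<le> (l + \<delta>) * ((\<phi> + \<delta>) * T x) + (emom N + \<delta>) * T x"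
      unfolding max_tail_split[OF \<open>0 \<le> x\<close>, of N A] by simp
    also have "\<dots> = ((l + \<delta>) * (\<phi> + \<delta>) + (emom N + \<delta>)) * T x" by (simp add: algebra_simps)
    also have "\<dots> \<le> (\<phi> * l + emom N + \<epsilon>) * T x"
      using \<delta> tail_pos[of x] by (intro mult_right_mono) auto
    finally show ?case .
  qed
qed

definition rate :: "enat \<Rightarrow> real" where
  "rate N = enn2real (limit_const W incr (cdf \<mu>) \<gamma> N)"

text \<open>A distribution is determined by its distribution function, so the Stieltjes measure of
  \<open>cdf \<mu>\<close> is \<mu> itself.\<close>

lemma mgf_cdf: "mgf (cdf \<mu>) \<gamma> = ennreal \<phi>"
proof -
  have "real_distribution (interval_measure (cdf \<mu>))"
    by (rule real_distribution_interval_measure)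
      (auto simp: cdf_nondecreasing cdf_is_right_cont cdf_lim_at_bot cdf_lim_at_top_prob)
  moreover have "cdf (interval_measure (cdf \<mu>)) = cdf \<mu>"
    by (rule cdf_interval_measure) (auto simp: cdf_nondecreasing cdf_is_right_cont cdf_lim_at_bot)
  ultimately have "interval_measure (cdf \<mu>) = \<mu>"
    using real_distribution_axioms by (intro cdf_unique)
  then show ?thesis by (simp add: mgf_def mgf_eq)
qed

lemma limit_const_enat: "limit_const W incr (cdf \<mu>) \<gamma> (enat m) = (\<Sum>n<m. ennreal (\<phi> ^ n * emom (enat (m - Suc n))))"
  unfolding limit_const_def
  by (simp, rule sum.reindex_bij_witness[of _ Suc "\<lambda>n. n - 1"])
    (auto simp: mgf_cdf moment_eq ennreal_mult phi_nonneg emom_nonneg ennreal_power)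

lemma rate_enat: "rate (enat m) = (\<Sum>n<m. \<phi> ^ n * emom (enat (m - Suc n)))"
  unfolding rate_def limit_const_enat
  by (subst sum_ennreal) (auto simp: phi_nonneg emom_nonneg sum_nonneg)

lemma limit_const_infinity: "limit_const W incr (cdf \<mu>) \<gamma> \<infinity> = ennreal (emom \<infinity> / (1 - \<phi>))"
proof -
  have "(\<lambda>n. \<phi> ^ n * emom \<infinity>) sums (1 / (1 - \<phi>) * emom \<infinity>)"
    using phi_nonneg phi_less_1 by (intro sums_mult2 geometric_sums) simp
  then have "(\<lambda>n. ennreal (\<phi> ^ n * emom \<infinity>)) sums ennreal (1 / (1 - \<phi>) * emom \<infinity>)"
    using phi_nonneg phi_less_1 emom_nonneg by (subst sums_ennreal) auto
  then show ?thesis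
    by (simp add: limit_const_def mgf_cdf moment_eq ennreal_power ennreal_mult phi_nonneg emom_nonneg sums_iff)
qed

lemma rate_infinity: "rate \<infinity> = emom \<infinity> / (1 - \<phi>)"
  using phi_less_1 by (simp add: rate_def limit_const_infinity emom_nonneg)

lemma rate_nonneg: "0 \<le> rate N"
  by (simp add: rate_def)

text \<open>The constants satisfy exactly the recursion of \<open>bound_rate_eSuc\<close>: the term
  n = 0 splits off, and every other term carries a factor \<phi>.\<close>

lemma rate_Suc: "rate (enat (Suc m)) = \<phi> * rate (enat m) + emom (enat m)"
proof -
  have "rate (enat (Suc m)) = emom (enat m) + (\<Sum>n<m. \<phi> * (\<phi> ^ n * emom (enat (m - Suc n))))"
    unfolding rate_enat by (subst sum.lessThan_Suc_shift) (simp add: mult.assoc)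
  then show ?thesis by (simp add: rate_enat sum_distrib_left)
qed

lemma bound_rate_finite: "bound_rate (enat m) (rate (enat m))"
proof (induction m)
  case 0
  have "max_tail (enat 0) x = 0" if "0 \<le> x" for x
    using that by (simp add: max_tail_def less_walk_max_ext_iff not_less)
  then show ?case
    by (auto simp: bound_rate_def rate_enat less_imp_le[OF tail_pos] intro!: eventually_at_top_linorderI[of 0])
next
  case (Suc m)
  then show ?case
    using bound_rate_eSuc[OF Suc rate_nonneg] by (simp add: rate_Suc eSuc_enat)
qed

text \<open>At the infinite horizon \<open>bound_rate_eSuc\<close> maps bounds to bounds by l
  \<mapsto> \<phi> l + \<open>emom \<infinity>\<close>. This is a contraction with fixed point
  \<open>rate \<infinity>\<close>, so iterating it from the crude bound K reaches the fixed point in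
  the limit.\<close>

lemma bound_rate_infinity: "bound_rate \<infinity> (rate \<infinity>)"
proof -
  obtain K where K: "K \<ge> 0" "\<And>z. max_tail \<infinity> z \<le> K * T z"
    using max_tail_bounded by blast
  \<comment> \<open>The closed form of the n-th iterate started at K.\<close>
  define l where "l n = \<phi> ^ n * (K - rate \<infinity>) + rate \<infinity>" for n
  have fix_eq: "rate \<infinity> = \<phi> * rate \<infinity> + emom \<infinity>"
    using phi_less_1 by (simp add: rate_infinity field_simps)
  \<comment> \<open>Each iterate is a convex combination of K and
    \<open>rate \<infinity>\<close>.\<close>
  have l_nonneg: "0 \<le> l n" for n
  proof -
    have "\<phi> ^ n * rate \<infinity> \<le> 1 * rate \<infinity>"
      using phi_nonneg phi_less_1 by (intro mult_right_mono power_le_one rate_nonneg) auto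
    then show ?thesis
      using mult_nonneg_nonneg[OF K(1) zero_le_power[OF phi_nonneg, of n]] by (simp add: l_def algebra_simps)
  qed
  have bound: "bound_rate \<infinity> (l n)" for n
  proof (induction n)
    case 0
    have "max_tail \<infinity> x \<le> (K + \<epsilon>) * T x" if "\<epsilon> > 0" for \<epsilon> x
      using that by (intro order_trans[OF K(2)] mult_right_mono less_imp_le[OF tail_pos]) simp
    then show ?case by (simp add: bound_rate_def l_def)
  next
    case (Suc n)
    have "bound_rate \<infinity> (\<phi> * l n + emom \<infinity>)"
      using bound_rate_eSuc[OF Suc l_nonneg] by simp
    also have "\<phi> * l n + emom \<infinity> = l (Suc n)"
      using fix_eq by (simp add: l_def algebra_simps)
    finally show ?case .
  qed
  have lim: "l \<longlonglongrightarrow> 0 * (K - rate \<infinity>) + rate \<infinity>"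
    unfolding l_def using phi_nonneg phi_less_1
    by (intro tendsto_intros LIMSEQ_realpow_zero) auto
  show ?thesis
    unfolding bound_rate_def
  proof (intro allI impI)
    fix \<epsilon> :: real assume "\<epsilon> > 0"
    then have "\<forall>\<^sub>F n in sequentially. l n < rate \<infinity> + \<epsilon> / 2"
      by (intro order_tendstoD[OF lim]) simp
    then obtain n where n: "l n < rate \<infinity> + \<epsilon> / 2"
      using eventually_happens by force
    have "\<forall>\<^sub>F x in at_top. max_tail \<infinity> x \<le> (l n + \<epsilon> / 2) * T x"
      using bound \<open>\<epsilon> > 0\<close> by (simp add: bound_rate_def)
    then show "\<forall>\<^sub>F x in at_top. max_tail \<infinity> x \<le> (rate \<infinity> + \<epsilon>) * T x"
    proof eventually_elim
      case (elim x)
      also have "(l n + \<epsilon> / 2) * T x \<le> (rate \<infinity> + \<epsilon>) * T x"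
        using n tail_pos[of x] by (intro mult_right_mono) auto
      finally show ?case .
    qed
  qed
qed

lemma bound_rate: "bound_rate N (rate N)"
  by (cases N) (auto intro: bound_rate_finite bound_rate_infinity)

text \<open>The constants increase and are bounded. Passing to the limit in the recursion identifies
  the limit as its unique fixed point.\<close>

lemma rate_tendsto: "(\<lambda>m. rate (enat m)) \<longlonglongrightarrow> rate \<infinity>"
proof -
  have fix_eq: "rate \<infinity> = \<phi> * rate \<infinity> + emom \<infinity>"
    using phi_less_1 by (simp add: rate_infinity field_simps)
  have "rate (enat m) \<le> rate \<infinity> \<and> rate (enat m) \<le> rate (enat (Suc m))" for m
  proof (induction m)
    case 0
    show ?case by (simp add: rate_enat rate_nonneg phi_nonneg emom_nonneg)
  next
    case (Suc m)
    have "rate (enat (Suc m)) \<le> \<phi> * rate \<infinity> + emom \<infinity>"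
      unfolding rate_Suc using Suc phi_nonneg by (intro add_mono mult_left_mono emom_mono) auto
    moreover have "\<phi> * rate (enat m) + emom (enat m) \<le> \<phi> * rate (enat (Suc m)) + emom (enat (Suc m))"
      using Suc phi_nonneg by (intro add_mono mult_left_mono emom_mono) auto
    ultimately show ?case using fix_eq by (simp add: rate_Suc)
  qed
  then have "incseq (\<lambda>m. rate (enat m))" "\<And>m. rate (enat m) \<le> rate \<infinity>"
    by (auto intro!: incseq_SucI)
  then obtain L where L: "(\<lambda>m. rate (enat m)) \<longlonglongrightarrow> L"
    using incseq_convergent by blast
  then have "(\<lambda>m. rate (enat (Suc m))) \<longlonglongrightarrow> L" by (rule LIMSEQ_Suc)
  moreover have "(\<lambda>m. rate (enat (Suc m))) \<longlonglongrightarrow> \<phi> * L + emom \<infinity>"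
    unfolding rate_Suc by (intro tendsto_intros L emom_tendsto)
  ultimately have "L = \<phi> * L + emom \<infinity>" by (rule LIMSEQ_unique)
  then have "L = rate \<infinity>" using phi_less_1 by (simp add: rate_infinity field_simps)
  with L show ?thesis by simp
qed

subsection \<open>One large step: lower bounds\<close>

text \<open>Counted from 0: the jump is step \<open>Suc n\<close>, so this is the part of {M_N > x}
  inside the event A_{n+1} with bounds a and x - a.\<close>

definition jump_event :: "enat \<Rightarrow> nat \<Rightarrow> real \<Rightarrow> real \<Rightarrow> (nat \<Rightarrow> real) set" where
  "jump_event N n a x =
    {s \<in> space W. ereal x < walk_max_ext incr N s \<and> walk_max incr n s \<le> a \<and> x - a < walk incr (Suc n) s}"

lemma jump_event_measurable [measurable]: "jump_event N n a x \<in> sets W"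
  unfolding jump_event_def by measurable

text \<open>A path is assembled from independent pieces: n steps of \<omega>, a jump y, and a
  continuation t. For fixed \<omega> with maximum at most A and fixed t, all y above a threshold
  lead into the event, and these have the probability T of that threshold.\<close>

lemma measure_jump_event_ge:
  assumes "A \<le> a"
  shows "(\<integral>p. indicator {p \<in> space (W \<Otimes>\<^sub>M W). walk_max incr n (fst p) \<le> A} p *
      T (x - (walk incr n (fst p) + trunc A (walk_max_ext incr K (snd p)))) \<partial>(W \<Otimes>\<^sub>M W))
    \<le> measure W (jump_event (enat (Suc n) + K) n a x)" (is "(\<integral>p. ?f p \<partial>_) \<le> measure W ?E")
proof -
  interpret P: pair_prob_space \<mu> W ..
  interpret PW: pair_prob_space W W ..
  have [measurable]: "(\<lambda>(\<omega>, t). comb_seq n \<omega> t) \<in> W \<Otimes>\<^sub>M W \<rightarrow>\<^sub>M W" by measurable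
  have "ennreal (\<integral>p. ?f p \<partial>(W \<Otimes>\<^sub>M W)) = (\<integral>\<^sup>+p. ennreal (?f p) \<partial>(W \<Otimes>\<^sub>M W))"
  proof (rule nn_integral_eq_integral[symmetric])
    show "integrable (W \<Otimes>\<^sub>M W) ?f"
      by (rule PW.integrable_const_bound[where B=1])
        (auto simp: indicator_def tail_le_1 abs_of_pos[OF tail_pos])
  qed (auto simp: less_imp_le[OF tail_pos])
  also have "\<dots> = (\<integral>\<^sup>+\<omega>. \<integral>\<^sup>+t. ennreal (?f (\<omega>, t)) \<partial>W \<partial>W)"
    by (rule Seq.P.nn_integral_fst[symmetric]) measurable
  also have "\<dots> \<le> (\<integral>\<^sup>+\<omega>. \<integral>\<^sup>+t. \<integral>\<^sup>+y. indicator ?E (comb_seq n \<omega> (case_nat y t)) \<partial>\<mu> \<partial>W \<partial>W)"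
  proof (intro nn_integral_mono)
    fix \<omega> t assume sp: "\<omega> \<in> space W" "t \<in> space W"
    show "ennreal (?f (\<omega>, t)) \<le> (\<integral>\<^sup>+y. indicator ?E (comb_seq n \<omega> (case_nat y t)) \<partial>\<mu>)"
    proof (cases "walk_max incr n \<omega> \<le> A")
      case True
      let ?u = "x - (walk incr n \<omega> + trunc A (walk_max_ext incr K t))"
      have "ennreal (?f (\<omega>, t)) = (\<integral>\<^sup>+y. indicator {?u<..} y \<partial>\<mu>)"
        using True sp by (simp add: tail_eq emeasure_eq_measure space_pair_measure)
      also have "\<dots> \<le> (\<integral>\<^sup>+y. indicator ?E (comb_seq n \<omega> (case_nat y t)) \<partial>\<mu>)"
      proof (rule nn_integral_mono)
        fix y
        show "indicator {?u<..} y \<le> (indicator ?E (comb_seq n \<omega> (case_nat y t)) :: ennreal)"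
        proof (cases "?u < y")
          case u: True
          then have "x < (y + walk incr n \<omega>) + trunc A (walk_max_ext incr K t)" by simp
          from last_jump_comb_seq[OF True this] have "comb_seq n \<omega> (case_nat y t) \<in> ?E"
            using \<open>A \<le> a\<close> by (auto simp: jump_event_def space_PiM)
          then show ?thesis by (simp add: indicator_def)
        qed simp
      qed
      finally show ?thesis .
    qed simp
  qed
  \<comment> \<open>The jump and the continuation merge into one sequence with law W; splicing it
    behind the first n terms of \<omega> then gives law W once more.\<close>
  also have "\<dots> = (\<integral>\<^sup>+\<omega>. \<integral>\<^sup>+t. indicator ?E (comb_seq n \<omega> t) \<partial>W \<partial>W)"
  proof (rule nn_integral_cong)
    fix \<omega> assume [measurable]: "\<omega> \<in> space W"
    have "(\<integral>\<^sup>+t. indicator ?E (comb_seq n \<omega> t) \<partial>W)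
      = (\<integral>\<^sup>+t. indicator ?E (comb_seq n \<omega> t) \<partial>distr (\<mu> \<Otimes>\<^sub>M W) W (\<lambda>(y, s). case_nat y s))"
      by (simp add: Seq.PiM_iter)
    also have "\<dots> = (\<integral>\<^sup>+p. indicator ?E (comb_seq n \<omega> (case_nat (fst p) (snd p))) \<partial>(\<mu> \<Otimes>\<^sub>M W))"
      by (subst nn_integral_distr) (auto simp: case_prod_beta)
    also have "\<dots> = (\<integral>\<^sup>+y. \<integral>\<^sup>+t. indicator ?E (comb_seq n \<omega> (case_nat y t)) \<partial>W \<partial>\<mu>)"
      by (subst Seq.P.nn_integral_fst[symmetric]) auto
    also have "\<dots> = (\<integral>\<^sup>+t. \<integral>\<^sup>+y. indicator ?E (comb_seq n \<omega> (case_nat y t)) \<partial>\<mu> \<partial>W)"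
      by (rule P.Fubini'[symmetric]) measurable
    finally show "(\<integral>\<^sup>+t. \<integral>\<^sup>+y. indicator ?E (comb_seq n \<omega> (case_nat y t)) \<partial>\<mu> \<partial>W)
      = (\<integral>\<^sup>+t. indicator ?E (comb_seq n \<omega> t) \<partial>W)" ..
  qed
  also have "\<dots> = (\<integral>\<^sup>+p. indicator ?E (comb_seq n (fst p) (snd p)) \<partial>(W \<Otimes>\<^sub>M W))"
    by (subst Seq.P.nn_integral_fst[symmetric]) auto
  also have "\<dots> = (\<integral>\<^sup>+s. indicator ?E s \<partial>distr (W \<Otimes>\<^sub>M W) W (\<lambda>(\<omega>, t). comb_seq n \<omega> t))"
    by (subst nn_integral_distr) (auto simp: case_prod_beta)
  also have "\<dots> = ennreal (measure W ?E)"
    by (simp add: Seq.PiM_comb_seq Seq.P.emeasure_eq_measure)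
  finally show ?thesis by (simp add: ennreal_le_iff)
qed

lemma tendsto_exp_walk_indicator:
  "((\<lambda>A. \<integral>s. indicator {s \<in> space W. walk_max incr n s \<le> A} s * exp (\<gamma> * walk incr n s) \<partial>W) \<longlongrightarrow> \<phi> ^ n) at_top"
proof -
  have int: "integrable W (\<lambda>s. exp (\<gamma> * walk incr n s))"
    by (rule integrableI_nn_integral_finite[where x="\<phi> ^ n"]) (auto simp: nn_integral_exp_walk phi_nonneg)
  have "(\<integral>s. exp (\<gamma> * walk incr n s) \<partial>W) = \<phi> ^ n"
    by (rule integral_eq_nn_integral[THEN trans]) (auto simp: nn_integral_exp_walk phi_nonneg)
  moreover have "((\<lambda>A. \<integral>s. indicator {s \<in> space W. walk_max incr n s \<le> A} s * exp (\<gamma> * walk incr n s) \<partial>W)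
      \<longlongrightarrow> (\<integral>s. exp (\<gamma> * walk incr n s) \<partial>W)) at_top"
  proof (rule integral_dominated_convergence_at_top[OF _ _ int])
    show "\<forall>\<^sub>F A in at_top. AE s in W. norm (indicator {s \<in> space W. walk_max incr n s \<le> A} s * exp (\<gamma> * walk incr n s))
        \<le> exp (\<gamma> * walk incr n s)"
      by (auto simp: indicator_def)
    show "AE s in W. ((\<lambda>A. indicator {s \<in> space W. walk_max incr n s \<le> A} s * exp (\<gamma> * walk incr n s))
        \<longlongrightarrow> exp (\<gamma> * walk incr n s)) at_top"
    proof (rule AE_I2)
      fix s assume "s \<in> space W"
      then show "((\<lambda>A. indicator {s \<in> space W. walk_max incr n s \<le> A} s * exp (\<gamma> * walk incr n s))
        \<longlongrightarrow> exp (\<gamma> * walk incr n s)) at_top"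
        by (intro tendsto_eventually eventually_at_top_linorderI[of "walk_max incr n s"]) simp
    qed
  qed measurable
  ultimately show ?thesis by simp
qed

text \<open>A constant A replaces h(x), since h(x) \<ge> A eventually. With A fixed, dominated
  convergence yields the product of the truncated moments, which exceeds c for large A.\<close>

lemma eventually_jump_event_ge:
  assumes h: "filterlim h at_top at_top" and c: "c < \<phi> ^ n * emom K"
  shows "\<forall>\<^sub>F x in at_top. c < measure W (jump_event (enat (Suc n) + K) n (h x) x) / T x"
proof -
  interpret PW: pair_prob_space W W ..
  have "((\<lambda>A. (\<integral>s. indicator {s \<in> space W. walk_max incr n s \<le> A} s * exp (\<gamma> * walk incr n s) \<partial>W) *
      (\<integral>s. exp (\<gamma> * trunc A (walk_max_ext incr K s)) \<partial>W)) \<longlongrightarrow> \<phi> ^ n * emom K) at_top"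
    by (intro tendsto_mult tendsto_exp_walk_indicator tendsto_exp_moment_trunc(1))
      (auto simp: walk_max_ext_not_MInf prob_space_W emom_nonneg moment_eq[unfolded exp_moment_max_def])
  from order_tendstoD(1)[OF this c] obtain A where
    A: "c < (\<integral>s. indicator {s \<in> space W. walk_max incr n s \<le> A} s * exp (\<gamma> * walk incr n s) \<partial>W) *
      (\<integral>s. exp (\<gamma> * trunc A (walk_max_ext incr K s)) \<partial>W)"
    using eventually_happens by force
  define B where "B = {p \<in> space (W \<Otimes>\<^sub>M W). walk_max incr n (fst p) \<le> A}"
  define U where "U p = walk incr n (fst p) + trunc A (walk_max_ext incr K (snd p))" for p
  have [measurable]: "B \<in> sets (W \<Otimes>\<^sub>M W)" "U \<in> borel_measurable (W \<Otimes>\<^sub>M W)"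
    unfolding B_def U_def[abs_def] by measurable
  \<comment> \<open>Before the jump the walk is at most A, and the truncated continuation adds at
    most A; this gives the domination.\<close>
  have U: "U p \<le> A + A" if "p \<in> B" for p
  proof -
    have "walk_max incr n (fst p) \<le> A" using that by (simp add: B_def)
    then have "walk incr n (fst p) \<le> A" by (simp add: walk_max_le_iff)
    then show ?thesis unfolding U_def by (intro add_mono trunc_le walk_max_ext_not_MInf)
  qed
  have "integrable (W \<Otimes>\<^sub>M W) (\<lambda>p. indicator B p * exp (\<gamma> * U p))"
    using U gamma_pos
    by (intro PW.integrable_const_bound[where B="exp (\<gamma> * (A + A))"]) (auto simp: indicator_def)
  then have "(\<integral>p. indicator B p * exp (\<gamma> * U p) \<partial>(W \<Otimes>\<^sub>M W))
      = (\<integral>\<omega>. \<integral>t. indicator B (\<omega>, t) * exp (\<gamma> * U (\<omega>, t)) \<partial>W \<partial>W)"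
    by (rule PW.integral_fst'[symmetric])
  \<comment> \<open>The steps before the jump and the continuation are independent, so the
    exponential moment factorizes.\<close>
  also have "\<dots> = (\<integral>\<omega>. \<integral>t. (indicator {s \<in> space W. walk_max incr n s \<le> A} \<omega> * exp (\<gamma> * walk incr n \<omega>)) *
      exp (\<gamma> * trunc A (walk_max_ext incr K t)) \<partial>W \<partial>W)"
    by (intro Bochner_Integration.integral_cong[OF refl])
      (auto simp: B_def U_def indicator_def space_pair_measure distrib_left exp_add)
  also have "\<dots> = (\<integral>s. indicator {s \<in> space W. walk_max incr n s \<le> A} s * exp (\<gamma> * walk incr n s) \<partial>W) *
      (\<integral>s. exp (\<gamma> * trunc A (walk_max_ext incr K s)) \<partial>W)"
    by simp
  finally have c': "c < (\<integral>p. indicator B p * exp (\<gamma> * U p) \<partial>(W \<Otimes>\<^sub>M W))" using A by simp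
  have "((\<lambda>x. (\<integral>p. indicator B p * T (x - U p) \<partial>(W \<Otimes>\<^sub>M W)) / T x)
      \<longlongrightarrow> (\<integral>p. indicator B p * exp (\<gamma> * U p) \<partial>(W \<Otimes>\<^sub>M W))) at_top"
  proof (rule tendsto_integral_tail_ratio)
    show "U p \<le> A + A" if "p \<in> B" for p using that by (rule U)
  qed (auto intro: PW.finite_measure_axioms)
  from order_tendstoD(1)[OF this c'] eventually_ge_at_top[of A, THEN filterlim_iff[THEN iffD1, OF h, rule_format]]
  show ?thesis
  proof eventually_elim
    case (elim x)
    note elim(1)
    also have "(\<integral>p. indicator B p * T (x - U p) \<partial>(W \<Otimes>\<^sub>M W)) / T x
        \<le> measure W (jump_event (enat (Suc n) + K) n (h x) x) / T x"
      using measure_jump_event_ge[OF elim(2), of n x K] tail_pos[of x]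
      unfolding B_def U_def by (intro divide_right_mono) auto
    finally show ?case .
  qed
qed

section \<open>Summing over the time of the jump\<close>

definition jump_prob :: "(real \<Rightarrow> real) \<Rightarrow> enat \<Rightarrow> real \<Rightarrow> real" where
  "jump_prob h N x = measure W ({s \<in> space W. ereal x < walk_max_ext incr N s} \<inter>
    (\<Union>n\<in>{n. 1 \<le> n \<and> enat n \<le> N}. walk_event W incr n (h x) (x - h x)))"

lemma walk_event_measurable [measurable]: "walk_event W incr n a x \<in> sets W"
  unfolding walk_event_def by measurable

lemma max_tail_mono:
  assumes "N \<le> N'"
  shows "max_tail N x \<le> max_tail N' x"
  unfolding max_tail_def
proof (rule Seq.P.finite_measure_mono)
  show "{s \<in> space W. ereal x < walk_max_ext incr N s} \<subseteq> {s \<in> space W. ereal x < walk_max_ext incr N' s}"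
    using less_le_trans[OF _ walk_max_ext_mono[OF assms]] by auto
qed measurable

lemma jump_prob_le: "jump_prob h N x \<le> max_tail N x"
  unfolding max_tail_def jump_prob_def by (intro Seq.P.finite_measure_mono) auto

lemma jump_prob_mono:
  assumes "N \<le> N'"
  shows "jump_prob h N x \<le> jump_prob h N' x"
  unfolding jump_prob_def
proof (intro Seq.P.finite_measure_mono Int_mono UN_mono)
  show "{s \<in> space W. ereal x < walk_max_ext incr N s} \<subseteq> {s \<in> space W. ereal x < walk_max_ext incr N' s}"
    using less_le_trans[OF _ walk_max_ext_mono[OF assms]] by auto
qed (auto intro: order_trans[OF _ assms])

text \<open>The events are disjoint: after the jump of event i the walk is above x - h(x) \<ge>
  h(x), whereas a later event j keeps it at or below h(x) up to time j.\<close>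

lemma sum_jump_event_le:
  assumes m: "enat m \<le> N" and hx: "h x \<le> x / 2"
  shows "(\<Sum>n<m. measure W (jump_event N n (h x) x)) \<le> jump_prob h N x"
proof -
  have False if "i < j" "s \<in> jump_event N i (h x) x" "s \<in> jump_event N j (h x) x" for i j s
  proof -
    have "walk incr (Suc i) s \<le> h x" "x - h x < walk incr (Suc i) s"
      using that by (auto simp: jump_event_def walk_max_le_iff)
    with hx show False by simp
  qed
  then have "disjoint_family_on (\<lambda>n. jump_event N n (h x) x) {..<m}"
    unfolding disjoint_family_on_def by (metis disjoint_iff nat_neq_iff)
  then have "(\<Sum>n<m. measure W (jump_event N n (h x) x)) = measure W (\<Union>n<m. jump_event N n (h x) x)"
    by (intro Seq.P.finite_measure_finite_Union[symmetric]) auto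
  also have "\<dots> \<le> jump_prob h N x"
    unfolding jump_prob_def
  proof (rule Seq.P.finite_measure_mono)
    show "(\<Union>n<m. jump_event N n (h x) x) \<subseteq> {s \<in> space W. ereal x < walk_max_ext incr N s} \<inter>
      (\<Union>n\<in>{n. 1 \<le> n \<and> enat n \<le> N}. walk_event W incr n (h x) (x - h x))"
    proof
      fix s assume "s \<in> (\<Union>n<m. jump_event N n (h x) x)"
      then obtain n where n: "n < m" "s \<in> jump_event N n (h x) x" by blast
      then have "enat (Suc n) \<le> N" using m by (metis Suc_leI enat_ord_simps(1) order_trans)
      moreover have "s \<in> walk_event W incr (Suc n) (h x) (x - h x)"
        using n by (simp add: jump_event_def walk_event_def)
      ultimately show "s \<in> {s \<in> space W. ereal x < walk_max_ext incr N s} \<inter>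
        (\<Union>n\<in>{n. 1 \<le> n \<and> enat n \<le> N}. walk_event W incr n (h x) (x - h x))"
        using n(2) by (auto simp: jump_event_def intro!: bexI[of _ "Suc n"])
    qed
  qed measurable
  finally show ?thesis .
qed

text \<open>Reduces the infinite series to a finite partial sum, because only finitely many
  asymptotic bounds can be combined. Here \<open>\<infinity> - enat (Suc n)\<close> is again
  \<open>\<infinity>\<close>.\<close>

lemma rate_approx:
  assumes "c < rate N"
  obtains m where "enat m \<le> N" "c < (\<Sum>n<m. \<phi> ^ n * emom (N - enat (Suc n)))"
proof (cases N)
  case (enat m)
  then show ?thesis using assms by (intro that[of m]) (auto simp: rate_enat)
next
  case infinity
  have "(\<lambda>n. \<phi> ^ n * emom \<infinity>) sums (1 / (1 - \<phi>) * emom \<infinity>)"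
    using phi_nonneg phi_less_1 by (intro sums_mult2 geometric_sums) simp
  then have "(\<lambda>m. \<Sum>n<m. \<phi> ^ n * emom \<infinity>) \<longlonglongrightarrow> rate \<infinity>"
    by (simp add: sums_def rate_infinity)
  from order_tendstoD(1)[OF this] assms obtain m where "c < (\<Sum>n<m. \<phi> ^ n * emom \<infinity>)"
    using eventually_happens infinity by force
  then show ?thesis by (intro that[of m]) (auto simp: infinity)
qed

lemma tendsto_jump_prob_max_tail:
  assumes h: "filterlim h at_top at_top" and hx: "\<And>x. x > 0 \<Longrightarrow> h x \<le> x / 2"
  shows "((\<lambda>x. jump_prob h N x / T x) \<longlongrightarrow> rate N) at_top"
    and "((\<lambda>x. max_tail N x / T x) \<longlongrightarrow> rate N) at_top"
proof -
  have le: "jump_prob h N x / T x \<le> max_tail N x / T x" for x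
    using tail_pos[of x] by (intro divide_right_mono jump_prob_le) simp
  have lower: "\<forall>\<^sub>F x in at_top. c < jump_prob h N x / T x" if c: "c < rate N" for c
  proof -
    obtain m where m: "enat m \<le> N" "c < (\<Sum>n<m. \<phi> ^ n * emom (N - enat (Suc n)))"
      using rate_approx[OF c] by blast
    \<comment> \<open>Every summand is lowered by \<delta>, so that the strict lower bound for each
      jump event applies while the sum stays above c.\<close>
    have "((\<lambda>\<delta>. \<Sum>n<m. \<phi> ^ n * emom (N - enat (Suc n)) - \<delta>) \<longlongrightarrow>
        (\<Sum>n<m. \<phi> ^ n * emom (N - enat (Suc n)) - 0)) (at_right 0)"
      by (intro tendsto_intros)
    then have "\<forall>\<^sub>F \<delta> in at_right 0. c < (\<Sum>n<m. \<phi> ^ n * emom (N - enat (Suc n)) - \<delta>)"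
      by (rule order_tendstoD) (use m in simp)
    then have "\<forall>\<^sub>F \<delta> in at_right 0. 0 < \<delta> \<and> c < (\<Sum>n<m. \<phi> ^ n * emom (N - enat (Suc n)) - \<delta>)"
      using eventually_at_right_less[of 0] by eventually_elim simp
    then obtain \<delta> where \<delta>: "0 < \<delta>" "c < (\<Sum>n<m. \<phi> ^ n * emom (N - enat (Suc n)) - \<delta>)"
      using eventually_happens by force
    \<comment> \<open>The continuation after step \<open>Suc n\<close> uses up exactly the remaining
      horizon.\<close>
    have N: "enat (Suc n) + (N - enat (Suc n)) = N" if "n < m" for n
      using that m(1) by (cases N) auto
    have "\<forall>\<^sub>F x in at_top. \<forall>n\<in>{..<m}. \<phi> ^ n * emom (N - enat (Suc n)) - \<delta>
        < measure W (jump_event N n (h x) x) / T x"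
    proof (rule eventually_ball_finite)
      show "\<forall>n\<in>{..<m}. \<forall>\<^sub>F x in at_top. \<phi> ^ n * emom (N - enat (Suc n)) - \<delta>
        < measure W (jump_event N n (h x) x) / T x"
      proof
        fix n assume "n \<in> {..<m}"
        then show "\<forall>\<^sub>F x in at_top. \<phi> ^ n * emom (N - enat (Suc n)) - \<delta>
          < measure W (jump_event N n (h x) x) / T x"
          using eventually_jump_event_ge[OF h, of "\<phi> ^ n * emom (N - enat (Suc n)) - \<delta>" n "N - enat (Suc n)"] \<delta> N[of n]
          by simp
      qed
    qed simp
    with eventually_gt_at_top[of 0] show ?thesis
    proof eventually_elim
      case (elim x)
      note \<delta>(2)
      also have "(\<Sum>n<m. \<phi> ^ n * emom (N - enat (Suc n)) - \<delta>) \<le> (\<Sum>n<m. measure W (jump_event N n (h x) x) / T x)"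
        by (intro sum_mono less_imp_le) (use elim in auto)
      also have "\<dots> = (\<Sum>n<m. measure W (jump_event N n (h x) x)) / T x"
        by (simp add: sum_divide_distrib)
      also have "\<dots> \<le> jump_prob h N x / T x"
        using sum_jump_event_le[of m N h x, OF m(1) hx] elim tail_pos[of x] by (intro divide_right_mono) auto
      finally show ?case .
    qed
  qed
  have upper: "\<forall>\<^sub>F x in at_top. max_tail N x / T x < c" if c: "rate N < c" for c
  proof -
    have "\<forall>\<^sub>F x in at_top. max_tail N x \<le> (rate N + (c - rate N) / 2) * T x"
      using bound_rate[of N] c by (simp add: bound_rate_def)
    then show ?thesis
    proof eventually_elim
      case (elim x)
      then have "max_tail N x / T x \<le> rate N + (c - rate N) / 2"
        using tail_pos[of x] by (simp add: pos_divide_le_eq)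
      also have "\<dots> < c" using c by (simp add: field_simps)
      finally show ?case .
    qed
  qed
  show "((\<lambda>x. jump_prob h N x / T x) \<longlongrightarrow> rate N) at_top"
    by (rule order_tendstoI[OF lower]) (auto intro: eventually_mono[OF upper] le_less_trans[OF le])
  show "((\<lambda>x. max_tail N x / T x) \<longlongrightarrow> rate N) at_top"
    by (rule order_tendstoI[OF _ upper]) (auto intro: eventually_mono[OF lower] less_le_trans[OF _ le])
qed

lemma uniform_limit_jump_prob_max_tail:
  assumes h: "filterlim h at_top at_top" and hx: "\<And>x. x > 0 \<Longrightarrow> h x \<le> x / 2"
  shows "uniform_limit {1..} (\<lambda>x N. jump_prob h N x / T x) rate at_top"
    and "uniform_limit {1..} (\<lambda>x N. max_tail N x / T x) rate at_top"
  by (rule uniform_limit_monotone_enat; use less_imp_le[OF tail_pos] in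
    \<open>simp add: rate_tendsto divide_right_mono jump_prob_mono max_tail_mono tendsto_jump_prob_max_tail[OF h hx]\<close>)+

end

section \<open>Return to the given distribution function and random walk\<close>

lemma class_S_light_tail:
  assumes "\<gamma> > 0" "F \<in> class_S \<gamma>" "mgf F \<gamma> < 1"
  shows "light_tail (interval_measure F) \<gamma> (enn2real (mgf F \<gamma>))" "cdf (interval_measure F) = F"
proof -
  have F: "distribution_function F" "\<And>x. tail F x > 0"
    "\<And>k. ((\<lambda>x. tail F (x - k) / tail F x) \<longlongrightarrow> exp (\<gamma> * k)) at_top" "mgf F \<gamma> < \<infinity>"
    "((\<lambda>x. tail (conv_df F F) x / (2 * enn2real (mgf F \<gamma>) * tail F x)) \<longlongrightarrow> 1) at_top"
    using assms(2) by (auto simp: class_S_def class_L_def)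
  then interpret real_distribution "interval_measure F"
    by (intro real_distribution_interval_measure) (auto simp: distribution_function_def mono_def)
  show cdf: "cdf (interval_measure F) = F"
    using F(1) by (intro cdf_interval_measure) (auto simp: distribution_function_def mono_def)
  have "enn2real (mgf F \<gamma>) < 1"
    using assms(3) by (cases "mgf F \<gamma>") (auto simp: ennreal_less_one_iff)
  moreover have "(\<integral>\<^sup>+ x. ennreal (exp (\<gamma> * x)) \<partial>interval_measure F) = ennreal (enn2real (mgf F \<gamma>))"
    using F(4) by (simp add: mgf_def)
  ultimately show "light_tail (interval_measure F) \<gamma> (enn2real (mgf F \<gamma>))"
    by unfold_locales (use F assms(1) in \<open>simp_all add: cdf conv_df_def\<close>)
qed

theorem theorem3:
  fixes P :: "'a measure" and \<xi> :: "nat \<Rightarrow> 'a \<Rightarrow> real"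
    and F :: "real \<Rightarrow> real" and \<gamma> :: real and h :: "real \<Rightarrow> real"
  assumes "\<gamma> > 0"
    and "F \<in> class_S \<gamma>"
    and "mgf F \<gamma> < 1"
    and "prob_space P"
    and "prob_space.indep_vars P (\<lambda>_. borel) \<xi> {1..}"
    and "\<And>n. n \<ge> 1 \<Longrightarrow> cdf (distr P borel (\<xi> n)) = F"
    and "\<And>x. x > 0 \<Longrightarrow> 0 < h x \<and> h x \<le> x / 2"
    and "filterlim h at_top at_top"
  shows "(\<forall>N\<ge>1. limit_const P \<xi> F \<gamma> N < \<infinity>) \<and>
    limit_const P \<xi> F \<gamma> \<infinity> = exp_moment_max P \<xi> \<gamma> \<infinity> / (1 - mgf F \<gamma>) \<and>
    uniform_limit {1..}
      (\<lambda>x N. measure P ({\<omega> \<in> space P. walk_max_ext \<xi> N \<omega> > ereal x} \<inter>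
                 (\<Union>n\<in>{n. 1 \<le> n \<and> enat n \<le> N}. walk_event P \<xi> n (h x) (x - h x))) / tail F x)
      (\<lambda>N. enn2real (limit_const P \<xi> F \<gamma> N)) at_top \<and>
    uniform_limit {1..}
      (\<lambda>x N. measure P {\<omega> \<in> space P. walk_max_ext \<xi> N \<omega> > ereal x} / tail F x)
      (\<lambda>N. enn2real (limit_const P \<xi> F \<gamma> N)) at_top"
proof -
  interpret P: prob_space P by fact
  define \<mu> where "\<mu> = interval_measure F"
  define \<phi> where "\<phi> = enn2real (mgf F \<gamma>)"
  interpret light_tail \<mu> \<gamma> \<phi>
    unfolding \<mu>_def \<phi>_def using assms(1-3) by (rule class_S_light_tail)
  have cdf: "cdf \<mu> = F"
    unfolding \<mu>_def using assms(1-3) by (rule class_S_light_tail)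
  have "distr P borel (\<xi> n) = \<mu>" if "n \<ge> 1" for n
  proof (rule cdf_unique)
    have "\<xi> n \<in> borel_measurable P"
      using assms(5) that by (auto simp: P.indep_vars_def)
    then show "real_distribution (distr P borel (\<xi> n))" by (rule P.real_distribution_distr)
  qed (use real_distribution_axioms cdf assms(6)[OF that] in auto)
  note X = P.distr_shifted_iid[OF assms(5) this prob_space_axioms events_eq_borel]
  let ?X = "\<lambda>\<omega> i. \<xi> (Suc i) \<omega>"
  \<comment> \<open>All events and moments are functions of the shifted increment sequence, so they
    can be evaluated under its law W.\<close>
  have walk: "walk \<xi> n \<omega> = walk incr n (?X \<omega>)" for n \<omega>
    unfolding walk_def by (intro sum.cong) (auto simp: incr_def)
  have walk_max: "walk_max \<xi> n \<omega> = walk_max incr n (?X \<omega>)" for n \<omega>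
    by (simp add: walk_max_def walk)
  have ext: "walk_max_ext \<xi> N \<omega> = walk_max_ext incr N (?X \<omega>)" for N \<omega>
    by (simp add: walk_max_ext_SUP walk)
  have measure_X: "measure P (?X -` E \<inter> space P) = measure W E" if "E \<in> sets W" for E
    using measure_distr[OF X(1) that] X(2) by simp
  have mom: "exp_moment_max P \<xi> \<gamma> N = moment N" for N
  proof -
    have "exp_moment_max P \<xi> \<gamma> N = (\<integral>\<^sup>+s. exp_ereal (ereal \<gamma> * walk_max_ext incr N s) \<partial>distr P W ?X)"
      unfolding exp_moment_max_def ext by (subst nn_integral_distr[OF X(1)]) auto
    then show ?thesis by (simp add: X(2) exp_moment_max_def)
  qed
  have lc: "limit_const P \<xi> F \<gamma> N = limit_const W incr (cdf \<mu>) \<gamma> N" for N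
    by (cases N) (simp_all add: limit_const_def mom cdf)
  have X_space: "?X \<omega> \<in> space W" for \<omega>
    by (simp add: space_PiM)
  have max_tail: "measure P {\<omega> \<in> space P. walk_max_ext \<xi> N \<omega> > ereal x} = max_tail N x" for N x
    unfolding max_tail_def
    by (subst measure_X[symmetric]) (auto simp: ext X_space intro!: arg_cong[where f="measure P"])
  have jump: "measure P ({\<omega> \<in> space P. walk_max_ext \<xi> N \<omega> > ereal x} \<inter>
      (\<Union>n\<in>{n. 1 \<le> n \<and> enat n \<le> N}. walk_event P \<xi> n (h x) (x - h x))) = jump_prob h N x" for N x
    unfolding jump_prob_def
    by (subst measure_X[symmetric])
      (auto simp: ext walk walk_max walk_event_def X_space intro!: arg_cong[where f="measure P"])
  have "limit_const P \<xi> F \<gamma> N < \<infinity>" for N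
    unfolding lc by (cases N) (auto simp: limit_const_enat limit_const_infinity)
  moreover have "limit_const P \<xi> F \<gamma> \<infinity> = exp_moment_max P \<xi> \<gamma> \<infinity> / (1 - mgf F \<gamma>)"
  proof -
    have "1 - mgf F \<gamma> = ennreal (1 - \<phi>)"
      using mgf_cdf phi_nonneg by (simp add: cdf ennreal_minus flip: ennreal_1)
    then show ?thesis
      unfolding lc limit_const_infinity mom moment_eq using phi_less_1
      by (simp add: divide_ennreal emom_nonneg)
  qed
  moreover have "(\<lambda>N. enn2real (limit_const P \<xi> F \<gamma> N)) = rate"
    by (simp add: fun_eq_iff rate_def lc)
  ultimately show ?thesis
    unfolding jump max_tail using uniform_limit_jump_prob_max_tail[OF assms(8)] assms(7) by (simp add: cdf)
qed

end
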